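(* Let $n\ge1$, $\alpha\in[0,1)$, and let $\tau\ge\lceil\frac23 n\rceil$. Let $G^\dagger$ be a graph having the minimum $A_\alpha$-index among all connected graphs of order $n$ with dissociation number $\tau$. Then $G^\dagger$ is a tree.
   Context: All graphs are simple and finite. For a graph $G$ with adjacency matrix $A(G)$ and diagonal degree matrix $D(G)$, and $\alpha\in[0,1]$, let $A_\alpha(G)=\alpha D(G)+(1-\alpha)A(G)$; its largest eigenvalue $\lambda_\alpha(G)$ is the $A_\alpha$-index of $G$. A set $S\subseteq V(G)$ is a dissociation set if $G[S]$ has maximum degree at most $1$; the dissociation number is the maximum size of a dissociation set. *)

theory Defs
  imports
    "HOL-Analysis.Analysis"
    "Graph_Theory.Graph_Theory"
    "Jordan_Normal_Form.Spectral_Radius"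
begin

text \<open>
  A finite simple graph is a \<^locale>\<open>pair_graph\<close>, i.e. a symmetric loop-free relation on a finite
  vertex set: the undirected edge $uv$ is the pair of arcs \<open>(u, v)\<close>, \<open>(v, u)\<close>, and the degree of a
  vertex is its out-degree. A graph of order \<open>n\<close> has the vertex set \<open>{0..<n}\<close>, so that vertices are
  the row and column indices of its matrices; every graph of order \<open>n\<close> is isomorphic to one of these.
\<close>

definition graph_of_order :: "nat \<Rightarrow> nat pair_pre_digraph \<Rightarrow> bool" where
  "graph_of_order n G \<longleftrightarrow> pair_graph G \<and> pverts G = {0..<n}"

definition adjacency_mat :: "nat pair_pre_digraph \<Rightarrow> real mat" where
  "adjacency_mat G = Matrix.mat (card (pverts G)) (card (pverts G))
     (\<lambda>(u, v). if (u, v) \<in> parcs G then 1 else 0)"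

definition degree_mat :: "nat pair_pre_digraph \<Rightarrow> real mat" where
  "degree_mat G = Matrix.mat (card (pverts G)) (card (pverts G))
     (\<lambda>(u, v). if u = v then real (out_degree (with_proj G) u) else 0)"

definition A_alpha :: "real \<Rightarrow> nat pair_pre_digraph \<Rightarrow> real mat" where
  "A_alpha \<alpha> G = \<alpha> \<cdot>\<^sub>m degree_mat G + (1 - \<alpha>) \<cdot>\<^sub>m adjacency_mat G"

definition A_alpha_index :: "real \<Rightarrow> nat pair_pre_digraph \<Rightarrow> real" where
  "A_alpha_index \<alpha> G = Max (spectrum (A_alpha \<alpha> G))"

definition dissociation_set :: "'a pair_pre_digraph \<Rightarrow> 'a set \<Rightarrow> bool" where
  "dissociation_set G S \<longleftrightarrow> S \<subseteq> pverts G \<and>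
     (\<forall>v\<in>S. out_degree (induce_subgraph (with_proj G) S) v \<le> 1)"

definition dissociation_number :: "'a pair_pre_digraph \<Rightarrow> nat" where
  "dissociation_number G = Max (card ` {S. dissociation_set G S})"

definition connected_graph :: "'a pair_pre_digraph \<Rightarrow> bool" where
  "connected_graph G \<longleftrightarrow> pair_graph G \<and> Digraph_Component.connected (with_proj G)"

text \<open>
  \<^const>\<open>Digraph_Component.tree\<close> is unsuitable here: in a symmetric digraph every edge yields the
  directed cycle \<open>u, v, u\<close>. The directed cycles of length at least 3 are exactly the cycles of the
  undirected graph.
\<close>

definition tree_graph :: "'a pair_pre_digraph \<Rightarrow> bool" where
  "tree_graph G \<longleftrightarrow> connected_graph G \<and>
     \<not> (\<exists>p. pre_digraph.cycle (with_proj G) p \<and> 3 \<le> length p)"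

definition connected_graphs :: "nat \<Rightarrow> nat \<Rightarrow> nat pair_pre_digraph set" where
  "connected_graphs n \<tau> =
     {G. graph_of_order n G \<and> connected_graph G \<and> dissociation_number G = \<tau>}"

end

theory Submission
  imports Defs
begin

text \<open>
  Minimise the index over all connected graphs of order $n$ with dissociation number at least $\tau$.
  Deleting an edge of a cycle does not lower the dissociation number and strictly lowers the index,
  so a minimiser is acyclic. Replacing one edge by another lowers the dissociation number by at most
  one. If a minimiser had dissociation number greater than $\tau$, it would not be a path, because
  the path has dissociation number $\lceil 2n/3 \rceil \le \tau$. Then choose the longest path
  $v, u_1, \dots, u_m$ that starts at a vertex of degree at least 3. Two further branches at $v$ are
  pendant paths $a_1, \dots, a_p$ and $b_1, \dots, b_q$ with $q \le m$, and replacing the edge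
  $v b_1$ by $a_p b_1$ strictly lowers the index: in the new graph, the mirror image about the middle
  of the path $v, a_1, \dots, a_p$ maps $b_1, \dots, b_q$ to $u_1, \dots, u_q$, so the entry of the
  Perron vector at $a_p$ is at most the one at $v$. Hence every minimiser has dissociation number
  exactly $\tau$, and $G$ is one of them.
\<close>

section \<open>Paths in graphs\<close>

definition graph_on :: "'a set \<Rightarrow> 'a rel \<Rightarrow> bool" where
  "graph_on V E \<longleftrightarrow> finite V \<and> E \<subseteq> V \<times> V \<and> sym E \<and> irrefl E"

definition connected_on :: "'a set \<Rightarrow> 'a rel \<Rightarrow> bool" where
  "connected_on V E \<longleftrightarrow> (\<forall>u\<in>V. \<forall>v\<in>V. (u, v) \<in> E\<^sup>*)"

definition vpath :: "'a rel \<Rightarrow> 'a list \<Rightarrow> bool" where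
  "vpath E p \<longleftrightarrow> distinct p \<and> successively (\<lambda>u v. (u, v) \<in> E) p"

text \<open>The list holds vertices, so length 3 is a triangle. The bound excludes a single edge
  traversed forth and back.\<close>

definition acyclic_graph :: "'a rel \<Rightarrow> bool" where
  "acyclic_graph E \<longleftrightarrow> \<not> (\<exists>p. vpath E p \<and> 3 \<le> length p \<and> (last p, hd p) \<in> E)"

lemma graph_onD:
  assumes "graph_on V E"
  shows "finite V" "finite E" "E \<subseteq> V \<times> V" "(u, v) \<in> E \<Longrightarrow> (v, u) \<in> E" "(u, u) \<notin> E" "finite (E `` {u})"
    "(u, v) \<in> E \<Longrightarrow> u \<in> V" "(u, v) \<in> E \<Longrightarrow> v \<in> V"
proof -
  show V: "finite V" and E: "E \<subseteq> V \<times> V" and "(u, u) \<notin> E"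
    using assms by (auto simp: graph_on_def irrefl_def)
  show "(u, v) \<in> E \<Longrightarrow> (v, u) \<in> E" using assms by (simp add: graph_on_def sym_def)
  show "(u, v) \<in> E \<Longrightarrow> u \<in> V" "(u, v) \<in> E \<Longrightarrow> v \<in> V" using E by auto
  show "finite E" using V E finite_subset by blast
  show "finite (E `` {u})" by (rule finite_subset[OF _ V]) (use E in auto)
qed

lemma vpath_rev: "graph_on V E \<Longrightarrow> vpath E (rev p) \<longleftrightarrow> vpath E p"
proof -
  assume "graph_on V E"
  then have "(\<lambda>u v. (v, u) \<in> E) = (\<lambda>u v. (u, v) \<in> E)"
    by (intro ext) (metis graph_onD(4))
  then show ?thesis unfolding vpath_def successively_rev distinct_rev by (rule arg_cong)
qed

lemma vpath_append:
  "vpath E (p @ q) \<longleftrightarrow> vpath E p \<and> vpath E q \<and> set p \<inter> set q = {} \<and>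
     (p \<noteq> [] \<longrightarrow> q \<noteq> [] \<longrightarrow> (last p, hd q) \<in> E)"
  by (auto simp: vpath_def successively_append_iff)

lemma vpath_Cons:
  "vpath E (a # p) \<longleftrightarrow> a \<notin> set p \<and> vpath E p \<and> (p \<noteq> [] \<longrightarrow> (a, hd p) \<in> E)"
  by (cases p) (auto simp: vpath_def)

lemma vpath_Nil [simp]: "vpath E []"
  by (simp add: vpath_def)

lemma vpath_mono:
  assumes "vpath E p" "\<And>u v. \<lbrakk>u \<in> set p; v \<in> set p; (u, v) \<in> E\<rbrakk> \<Longrightarrow> (u, v) \<in> F"
  shows "vpath F p"
  using assms(1) successively_mono[of "\<lambda>u v. (u, v) \<in> E" p "\<lambda>u v. (u, v) \<in> F"] assms(2)
  by (simp add: vpath_def)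

text \<open>A vertex that lies on an edge is in \<open>V\<close>. The one-vertex list is excluded
  because it contains no edge.\<close>

lemma vpath_subset:
  assumes G: "graph_on V E" and "vpath E p" "length p \<noteq> 1"
  shows "set p \<subseteq> V"
proof -
  have "length p = 1 \<or> set p \<subseteq> V" using assms(2)
  proof (induction p rule: induct_list012)
    case (3 x y zs)
    then show ?case using graph_onD(7,8)[OF G] by (auto simp: vpath_Cons length_Suc_conv)
  qed auto
  then show ?thesis using assms(3) by simp
qed

lemma vpath_rtrancl: "vpath E p \<Longrightarrow> u \<in> set p \<Longrightarrow> (hd p, u) \<in> E\<^sup>*"
proof (induction p)
  case (Cons a p)
  then show ?case by (cases p) (auto simp: vpath_Cons intro: converse_rtrancl_into_rtrancl)
qed simp

text \<open>If \<open>z\<close> occurred in \<open>p\<close>, the segment from \<open>z\<close> to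
  \<open>y\<close> would be closed into a cycle by the edge from \<open>y\<close> to
  \<open>z\<close>. Hence a path in an acyclic graph can always be prolonged through a neighbour
  other than the previous vertex.\<close>

lemma acyclic_nbr_notin:
  assumes G: "graph_on V E" and "acyclic_graph E" and p: "vpath E (p @ [x, y])"
    and z: "(y, z) \<in> E" "z \<noteq> x"
  shows "z \<notin> set (p @ [x, y])"
proof
  assume "z \<in> set (p @ [x, y])"
  moreover have "z \<noteq> y" using z graph_onD(5)[OF G] by auto
  ultimately have "z \<in> set p" using z by auto
  then obtain p1 p2 where "p = p1 @ z # p2" by (meson split_list)
  then have "vpath E (z # p2 @ [x, y])" using p by (simp add: vpath_append)
  moreover have "3 \<le> length (z # p2 @ [x, y])" "(last (z # p2 @ [x, y]), hd (z # p2 @ [x, y])) \<in> E"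
    using z by auto
  ultimately show False using \<open>acyclic_graph E\<close> unfolding acyclic_graph_def by blast
qed

section \<open>Dissociation sets on a path, and longest paths\<close>

definition dissoc :: "'a rel \<Rightarrow> 'a set \<Rightarrow> bool" where
  "dissoc E S \<longleftrightarrow> (\<forall>v\<in>S. card (S \<inter> E `` {v}) \<le> 1)"

text \<open>Of three consecutive path vertices at most two lie in \<open>S\<close>, since otherwise
  the middle one has two neighbours in \<open>S\<close>. The induction removes three vertices at a
  time; the summand 2 pays for a rest of at most two vertices, all of which may lie in
  \<open>S\<close>.\<close>

lemma dissoc_path_bound:
  assumes G: "graph_on V E" and S: "dissoc E S" "finite S"
  shows "vpath E p \<Longrightarrow> 3 * card (S \<inter> set p) \<le> 2 * length p + 2"
proof (induction "length p" arbitrary: p rule: less_induct)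
  case less
  consider "p = []" | a where "p = [a]" | a b where "p = [a, b]" | a b c q where "p = a # b # c # q"
    by (metis list.exhaust)
  then show ?case
  proof cases
    case 1 then show ?thesis by simp
  next
    case 2
    have "card (S \<inter> {a}) \<le> card {a}" by (intro card_mono) auto
    then show ?thesis using 2 by simp
  next
    case 3
    have "card (S \<inter> {a, b}) \<le> card {a, b}" by (intro card_mono) auto
    also have "\<dots> \<le> 2" by (simp add: card_insert_if)
    finally show ?thesis using 3 by simp
  next
    case 4
    then have pq: "vpath E q" and e: "(a, b) \<in> E" "(b, c) \<in> E" "a \<noteq> c" "a \<noteq> b" "b \<noteq> c"
      using less.prems by (auto simp: vpath_Cons)
    have "\<not> {a, b, c} \<subseteq> S"
    proof
      assume s: "{a, b, c} \<subseteq> S"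
      then have "{a, c} \<subseteq> S \<inter> E `` {b}" using e graph_onD(4)[OF G] by auto
      then have "card {a, c} \<le> card (S \<inter> E `` {b})" using S by (intro card_mono) auto
      then show False using S(1) s e(3) by (auto simp: dissoc_def)
    qed
    then have "S \<inter> {a, b, c} \<subset> {a, b, c}" by blast
    then have "card (S \<inter> {a, b, c}) < card {a, b, c}" by (intro psubset_card_mono) auto
    also have "\<dots> = 3" using e by simp
    finally have "card (S \<inter> {a, b, c}) \<le> 2" by simp
    moreover have "card (S \<inter> set p) \<le> card (S \<inter> {a, b, c}) + card (S \<inter> set q)"
      by (rule order_trans[OF card_mono card_Un_le]) (use 4 in auto)
    moreover have "3 * card (S \<inter> set q) \<le> 2 * length q + 2" using less.hyps[of q] pq 4 by simp
    ultimately show ?thesis using 4 by simp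
  qed
qed

lemma dissoc_subset:
  assumes "dissoc E S" "F \<subseteq> E" "finite S" "T \<subseteq> S"
  shows "dissoc F T"
  unfolding dissoc_def
proof
  fix v assume "v \<in> T"
  have "card (T \<inter> F `` {v}) \<le> card (S \<inter> E `` {v})"
    using assms by (intro card_mono) auto
  also have "\<dots> \<le> 1" using assms \<open>v \<in> T\<close> by (auto simp: dissoc_def)
  finally show "card (T \<inter> F `` {v}) \<le> 1" .
qed

text \<open>Lengths are bounded by \<open>card V\<close>. The predicate is left abstract because
  three kinds of longest path are taken: an arbitrary one, a branch continuing a given path, and one
  that ends at a vertex of degree at least 3.\<close>

lemma longest_path_ex:
  assumes "finite V" and "P p0" and P: "\<And>p. P p \<Longrightarrow> distinct p \<and> set p \<subseteq> V"
  shows "\<exists>p. P p \<and> (\<forall>q. P q \<longrightarrow> length q \<le> length p)"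
proof (rule ex_has_greatest_nat[of P p0 length "Suc (card V)"])
  show "P p0" by fact
  show "\<forall>y. P y \<longrightarrow> length y < Suc (card V)"
    using P card_mono[OF assms(1)] by (force simp: distinct_card[symmetric] less_Suc_eq_le)
qed

lemma rtrancl_exit_edge:
  assumes "(u, v) \<in> E\<^sup>*" "u \<in> S" "v \<notin> S"
  shows "\<exists>s t. (s, t) \<in> E \<and> s \<in> S \<and> t \<notin> S"
  using assms(1,3)
proof (induction rule: rtrancl_induct)
  case base
  then show ?case using assms(2) by simp
next
  case (step y z)
  then show ?case by (cases "y \<in> S") auto
qed

text \<open>If a longest path missed a vertex, connectedness would give an edge from some
  \<open>s\<close> on the path to some \<open>t\<close> off it. At an end of the path
  \<open>t\<close> prolongs it, and at an inner vertex \<open>s\<close> would have three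
  neighbours.\<close>

lemma hamiltonian_path_ex:
  assumes G: "graph_on V E" and conn: "connected_on V E"
    and deg: "\<And>v. card (E `` {v}) \<le> 2"
  shows "\<exists>p. vpath E p \<and> set p = V"
proof -
  obtain p where p: "vpath E p" "set p \<subseteq> V"
    and max: "\<And>q. vpath E q \<Longrightarrow> set q \<subseteq> V \<Longrightarrow> length q \<le> length p"
    using longest_path_ex[of V "\<lambda>p. vpath E p \<and> set p \<subseteq> V" "[]"] graph_onD(1)[OF G]
    by (auto simp: vpath_def)
  have "set p = V"
  proof (rule ccontr)
    assume "set p \<noteq> V"
    then obtain y where y: "y \<in> V" "y \<notin> set p" using p by auto
    have "p \<noteq> []" using max[of "[y]"] y by (auto simp: vpath_def)
    then obtain x where x: "x \<in> set p" by (cases p) auto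
    then have "(x, y) \<in> E\<^sup>*" using conn y p by (auto simp: connected_on_def)
    then obtain s t where st: "(s, t) \<in> E" "s \<in> set p" "t \<notin> set p"
      using rtrancl_exit_edge[of x y E "set p"] x y by auto
    have tV: "t \<in> V" "(t, s) \<in> E" using graph_onD[OF G] st by auto
    obtain p1 p2 where p12: "p = p1 @ s # p2" using st by (meson split_list)
    have "p1 \<noteq> []"
    proof
      assume "p1 = []"
      then have "vpath E (t # p)" using p st tV p12 by (simp add: vpath_Cons)
      then show False using max[of "t # p"] p tV by auto
    qed
    then obtain p1' a where a: "p1 = p1' @ [a]" by (metis rev_exhaust)
    have "p2 \<noteq> []"
    proof
      assume "p2 = []"
      then have "vpath E (p @ [t])" using p st p12 by (auto simp: vpath_append vpath_Cons)
      then show False using max[of "p @ [t]"] p tV by auto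
    qed
    then obtain b p2' where b: "p2 = b # p2'" by (cases p2) auto
    have "(s, a) \<in> E" "(s, b) \<in> E" "a \<noteq> b" "a \<noteq> t" "b \<noteq> t"
      using p(1) p12 a b st graph_onD(4)[OF G] by (auto simp: vpath_append vpath_Cons)
    then have "{a, b, t} \<subseteq> E `` {s}" "card {a, b, t} = 3" using st by auto
    then have "3 \<le> card (E `` {s})" using card_mono[OF graph_onD(6)[OF G], of "{a, b, t}" s] by simp
    then show False using deg[of s] by simp
  qed
  then show ?thesis using p by auto
qed

section \<open>The quadratic form and its maximisers\<close>

definition A_act :: "real \<Rightarrow> 'a rel \<Rightarrow> ('a \<Rightarrow> real) \<Rightarrow> 'a \<Rightarrow> real" where
  "A_act \<alpha> E x u = \<alpha> * real (card (E `` {u})) * x u + (1 - \<alpha>) * (\<Sum>v\<in>E `` {u}. x v)"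

text \<open>This is the quadratic form of the matrix. The sum runs over arcs, so a vertex
  contributes its square once per incident edge, which produces the degree term, and each edge
  contributes its product twice.\<close>

definition A_form :: "real \<Rightarrow> 'a rel \<Rightarrow> ('a \<Rightarrow> real) \<Rightarrow> real" where
  "A_form \<alpha> E x = (\<Sum>(u, v)\<in>E. \<alpha> * (x u)\<^sup>2 + (1 - \<alpha>) * (x u * x v))"

text \<open>The first clause makes \<open>x\<close> a positive eigenvector for \<open>l\<close>; the
  second is the Rayleigh bound, which makes \<open>l\<close> the largest eigenvalue.\<close>

definition perron_pair :: "real \<Rightarrow> 'a set \<Rightarrow> 'a rel \<Rightarrow> real \<Rightarrow> ('a \<Rightarrow> real) \<Rightarrow> bool" where
  "perron_pair \<alpha> V E l x \<longleftrightarrow> (\<forall>u\<in>V. 0 < x u \<and> A_act \<alpha> E x u = l * x u) \<and>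
     (\<forall>y. A_form \<alpha> E y \<le> l * (\<Sum>u\<in>V. (y u)\<^sup>2))"

lemma sum_arcs:
  fixes f :: "'a \<Rightarrow> 'a \<Rightarrow> real"
  assumes "graph_on V E"
  shows "(\<Sum>(u, v)\<in>E. f u v) = (\<Sum>u\<in>V. \<Sum>v\<in>E `` {u}. f u v)"
proof -
  have "E = Sigma V (\<lambda>u. E `` {u})" using graph_onD(3)[OF assms] by auto
  then have "(\<Sum>(u, v)\<in>E. f u v) = (\<Sum>(u, v)\<in>Sigma V (\<lambda>u. E `` {u}). f u v)" by simp
  also have "\<dots> = (\<Sum>u\<in>V. \<Sum>v\<in>E `` {u}. f u v)"
    using graph_onD(1,6)[OF assms] by (subst sum.Sigma) auto
  finally show ?thesis .
qed

lemma sum_arcs_swap: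
  fixes f :: "'a \<Rightarrow> 'a \<Rightarrow> real"
  assumes "graph_on V E"
  shows "(\<Sum>(u, v)\<in>E. f u v) = (\<Sum>(u, v)\<in>E. f v u)"
  by (rule sum.reindex_bij_witness[of _ prod.swap prod.swap])
    (use graph_onD(4)[OF assms] in auto)

text \<open>Second-order expansion of the form. By symmetry of \<open>E\<close> the two mixed sums
  agree, so the linear term is twice the product of \<open>h\<close> with the image of
  \<open>x\<close>.\<close>

lemma A_form_add:
  assumes G: "graph_on V E"
  shows "A_form \<alpha> E (\<lambda>u. x u + t * h u) =
    A_form \<alpha> E x + 2 * t * (\<Sum>u\<in>V. h u * A_act \<alpha> E x u) + t\<^sup>2 * A_form \<alpha> E h"
proof -
  have 1: "(\<Sum>u\<in>V. h u * A_act \<alpha> E x u) =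
      \<alpha> * (\<Sum>(u, v)\<in>E. x u * h u) + (1 - \<alpha>) * (\<Sum>(u, v)\<in>E. h u * x v)"
    unfolding sum_arcs[OF G] A_act_def sum_distrib_left sum.distrib[symmetric]
    by (rule sum.cong) (auto simp: sum.distrib sum_subtractf sum_distrib_left algebra_simps)
  have 2: "(\<Sum>(u, v)\<in>E. h u * x v) = (\<Sum>(u, v)\<in>E. x u * h v)"
    by (subst sum_arcs_swap[OF G]) (simp add: mult.commute)
  have "A_form \<alpha> E (\<lambda>u. x u + t * h u) =
      (\<Sum>(u, v)\<in>E. (\<alpha> * (x u)\<^sup>2 + (1 - \<alpha>) * (x u * x v))
        + 2 * t * (\<alpha> * (x u * h u)) + t * (1 - \<alpha>) * (h u * x v) + t * (1 - \<alpha>) * (x u * h v)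
        + t\<^sup>2 * (\<alpha> * (h u)\<^sup>2 + (1 - \<alpha>) * (h u * h v)))"
    unfolding A_form_def by (rule sum.cong) (auto simp: algebra_simps power2_eq_square)
  also have "\<dots> = A_form \<alpha> E x + 2 * t * (\<alpha> * (\<Sum>(u, v)\<in>E. x u * h u))
      + t * (1 - \<alpha>) * (\<Sum>(u, v)\<in>E. h u * x v) + t * (1 - \<alpha>) * (\<Sum>(u, v)\<in>E. x u * h v)
      + t\<^sup>2 * A_form \<alpha> E h"
    unfolding A_form_def
    by (simp only: case_prod_unfold sum.distrib sum_distrib_left[symmetric] mult.assoc)
  also have "\<dots> = A_form \<alpha> E x + 2 * t * (\<Sum>u\<in>V. h u * A_act \<alpha> E x u) + t\<^sup>2 * A_form \<alpha> E h"
    unfolding 1 2[symmetric] by (simp add: algebra_simps)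
  finally show ?thesis .
qed

lemma A_form_eq:
  assumes G: "graph_on V E"
  shows "A_form \<alpha> E x = (\<Sum>u\<in>V. x u * A_act \<alpha> E x u)"
  unfolding A_form_def sum_arcs[OF G] A_act_def
  by (rule sum.cong) (auto simp: sum.distrib sum_subtractf sum_distrib_left algebra_simps power2_eq_square)

lemma linear_coeff_zero:
  fixes a b :: real
  assumes "\<And>t. a * t + b * t\<^sup>2 \<le> 0"
  shows "a = 0"
proof -
  \<comment> \<open>At \<open>t = a / c\<close> the assumption becomes
    \<open>a * a * (b + c) / (c * c) \<le> 0\<close>; this choice makes \<open>c\<close> positive
    and \<open>b + c\<close> at least 1.\<close>
  define c where "c = \<bar>b\<bar> + 1"
  have c: "c > 0" "b + c \<ge> 1" by (auto simp: c_def)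
  have "a * (a / c) + b * (a / c)\<^sup>2 = a\<^sup>2 * (b + c) / c\<^sup>2"
    using c(1) by (simp add: field_simps power2_eq_square)
  with assms[of "a / c"] have "a\<^sup>2 * (b + c) \<le> 0"
    using c(1) by (simp add: divide_le_0_iff)
  moreover have "a\<^sup>2 * 1 \<le> a\<^sup>2 * (b + c)" using c by (intro mult_left_mono) auto
  ultimately have "a\<^sup>2 \<le> 0" by linarith
  then show ?thesis by simp
qed

text \<open>Perturb \<open>x\<close> by \<open>t\<close> times the unit vector at \<open>w\<close>.
  The Rayleigh bound is attained at \<open>t = 0\<close>, so the linear coefficient vanishes; it is
  twice the defect of the eigenvalue equation at \<open>w\<close>.\<close>

lemma A_form_maximizer:
  assumes G: "graph_on V E" and max: "\<And>y. A_form \<alpha> E y \<le> l * (\<Sum>u\<in>V. (y u)\<^sup>2)"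
    and eq: "A_form \<alpha> E x = l * (\<Sum>u\<in>V. (x u)\<^sup>2)" and w: "w \<in> V"
  shows "A_act \<alpha> E x w = l * x w"
proof -
  define h :: "'a \<Rightarrow> real" where "h = (\<lambda>u. if u = w then 1 else 0)"
  have V: "finite V" using G graph_onD by auto
  have sq: "(\<Sum>u\<in>V. (x u + t * h u)\<^sup>2) = (\<Sum>u\<in>V. (x u)\<^sup>2) + 2 * t * x w + t\<^sup>2" for t
  proof -
    have "(\<Sum>u\<in>V. (x u + t * h u)\<^sup>2) = (\<Sum>u\<in>V. (x u)\<^sup>2 + (if u = w then 2 * t * x w + t\<^sup>2 else 0))"
      by (rule sum.cong) (auto simp: h_def power2_eq_square algebra_simps)
    then show ?thesis using V w by (simp add: sum.distrib)
  qed
  have act: "(\<Sum>u\<in>V. h u * A_act \<alpha> E x u) = A_act \<alpha> E x w"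
    using V w by (simp add: h_def if_distrib[of "\<lambda>z. z * _"] cong: if_cong)
  have "2 * (A_act \<alpha> E x w - l * x w) * t + (A_form \<alpha> E h - l) * t\<^sup>2 \<le> 0" for t
    using max[of "\<lambda>u. x u + t * h u"] unfolding A_form_add[OF G] sq act eq
    by (simp add: algebra_simps)
  from linear_coeff_zero[OF this] show ?thesis by simp
qed

lemma A_form_abs:
  assumes "0 \<le> \<alpha>" "\<alpha> < 1" shows "A_form \<alpha> E x \<le> A_form \<alpha> E (\<lambda>u. \<bar>x u\<bar>)"
  unfolding A_form_def
proof (rule sum_mono, clarify)
  fix u v
  have "x u * x v \<le> \<bar>x u\<bar> * \<bar>x v\<bar>" by (metis abs_ge_self abs_mult)
  then show "\<alpha> * (x u)\<^sup>2 + (1 - \<alpha>) * (x u * x v) \<le> \<alpha> * \<bar>x u\<bar>\<^sup>2 + (1 - \<alpha>) * (\<bar>x u\<bar> * \<bar>x v\<bar>)"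
    using assms by (auto intro: mult_left_mono)
qed

text \<open>Tychonoff's theorem for the topology of the function type.\<close>

lemma compact_functions:
  assumes "\<And>i. compact (S i)"
  shows "compact {x :: 'a \<Rightarrow> real. \<forall>i. x i \<in> S i}"
proof -
  have "compactin (product_topology (\<lambda>i. euclidean) UNIV) (PiE UNIV S)"
    using assms by (subst compactin_PiE) (auto simp: compactin_euclidean_iff)
  moreover have "PiE UNIV S = {x. \<forall>i. x i \<in> S i}" by (auto simp: PiE_def)
  ultimately show ?thesis by (simp add: euclidean_product_topology compactin_euclidean_iff)
qed

text \<open>The form attains its maximum on the unit sphere, and scaling gives the bound for all
  \<open>y\<close>. Functions are set to 0 outside \<open>V\<close>, so that the sphere is a closed
  part of a compact product even if the vertex type is infinite.\<close>

lemma A_form_maximizer_ex: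
  assumes G: "graph_on V E" and "V \<noteq> {}"
  shows "\<exists>x. (\<Sum>u\<in>V. (x u)\<^sup>2) = 1 \<and> (\<forall>y. A_form \<alpha> E y \<le> A_form \<alpha> E x * (\<Sum>u\<in>V. (y u)\<^sup>2))"
proof -
  have V: "finite V" using G graph_onD by auto
  define S where "S = {x :: 'a \<Rightarrow> real. \<forall>i. x i \<in> (if i \<in> V then {-1..1} else {0})}"
  define T where "T = S \<inter> {x. (\<Sum>u\<in>V. (x u)\<^sup>2) = 1}"
  have cont: "continuous_on UNIV (\<lambda>x :: 'a \<Rightarrow> real. x i)" for i by simp
  have "compact S" unfolding S_def by (rule compact_functions) auto
  moreover have "closed {x :: 'a \<Rightarrow> real. (\<Sum>u\<in>V. (x u)\<^sup>2) = 1}"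
    by (intro closed_Collect_eq continuous_intros cont)
  ultimately have "compact T" unfolding T_def by (rule compact_Int_closed)
  have normalize: "(\<lambda>i. if i \<in> V then y i / sqrt (\<Sum>u\<in>V. (y u)\<^sup>2) else 0) \<in> T"
    if y: "(\<Sum>u\<in>V. (y u)\<^sup>2) > 0" for y
  proof -
    define s where "s = (\<Sum>u\<in>V. (y u)\<^sup>2)"
    have "\<bar>y i\<bar> \<le> sqrt s" if "i \<in> V" for i
      using member_le_sum[of i V "\<lambda>u. (y u)\<^sup>2"] that V
      unfolding s_def by (metis real_sqrt_abs real_sqrt_le_mono zero_le_power2)
    moreover have "(\<Sum>u\<in>V. (y u / sqrt s)\<^sup>2) = 1"
      using y by (simp add: s_def power_divide sum_divide_distrib[symmetric])
    ultimately show ?thesis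
      using y unfolding T_def S_def s_def[symmetric]
      by (auto simp: divide_le_eq_1 le_divide_eq abs_le_iff) (metis minus_le_iff)
  qed
  have "(\<Sum>u\<in>V. ((\<lambda>_. 1 :: real) u)\<^sup>2) > 0" using V \<open>V \<noteq> {}\<close> by (simp add: card_gt_0_iff)
  then have "T \<noteq> {}" using normalize[of "\<lambda>_. 1"] by blast
  have "continuous_on T (A_form \<alpha> E)"
    unfolding A_form_def case_prod_unfold
    by (intro continuous_intros continuous_on_subset[OF cont]) auto
  from continuous_attains_sup[OF \<open>compact T\<close> \<open>T \<noteq> {}\<close> this]
  obtain x where x: "x \<in> T" and max: "\<And>y. y \<in> T \<Longrightarrow> A_form \<alpha> E y \<le> A_form \<alpha> E x" by blast
  have "A_form \<alpha> E y \<le> A_form \<alpha> E x * (\<Sum>u\<in>V. (y u)\<^sup>2)" for y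
  proof (cases "(\<Sum>u\<in>V. (y u)\<^sup>2) > 0")
    case True
    define s where "s = (\<Sum>u\<in>V. (y u)\<^sup>2)"
    have s: "s > 0" using True s_def by simp
    have "A_form \<alpha> E (\<lambda>i. if i \<in> V then y i / sqrt s else 0) = (\<Sum>(u, v)\<in>E. (\<alpha> * (y u)\<^sup>2 + (1 - \<alpha>) * (y u * y v)) / s)"
      unfolding A_form_def
      by (rule sum.cong) (use graph_onD(3)[OF G] s in \<open>auto simp: power_divide add_divide_distrib\<close>)
    also have "\<dots> = A_form \<alpha> E y / s"
      by (simp only: A_form_def case_prod_unfold sum_divide_distrib)
    finally have "A_form \<alpha> E y / s \<le> A_form \<alpha> E x"
      using max[OF normalize[OF True]] unfolding s_def[symmetric] by simp
    then show ?thesis using s unfolding s_def[symmetric] by (simp add: field_simps)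
  next
    case False
    then have "(\<Sum>u\<in>V. (y u)\<^sup>2) = 0" by (simp add: sum_nonneg order_less_le)
    then have "\<forall>u\<in>V. y u = 0" using V by (simp add: sum_nonneg_eq_0_iff)
    then have "A_form \<alpha> E y = 0"
      unfolding A_form_def using graph_onD(3)[OF G] by (intro sum.neutral) auto
    then show ?thesis using \<open>(\<Sum>u\<in>V. (y u)\<^sup>2) = 0\<close> by simp
  qed
  then show ?thesis using x by (auto simp: T_def)
qed

text \<open>Taking absolute values in a maximiser gives another maximiser \<open>z\<close>, hence an
  eigenvector. Where \<open>z\<close> vanishes, the eigenvalue equation makes it vanish at all
  neighbours, so by connectedness everywhere, against its norm being 1.\<close>

lemma perron_pair_ex:
  assumes G: "graph_on V E" and conn: "connected_on V E" and ne: "V \<noteq> {}" and \<alpha>: "0 \<le> \<alpha>" "\<alpha> < 1"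
  shows "\<exists>l x. perron_pair \<alpha> V E l x"
proof -
  have V: "finite V" using G graph_onD by auto
  obtain x where x: "(\<Sum>u\<in>V. (x u)\<^sup>2) = 1"
    and max: "\<And>y. A_form \<alpha> E y \<le> A_form \<alpha> E x * (\<Sum>u\<in>V. (y u)\<^sup>2)"
    using A_form_maximizer_ex[OF G ne] by blast
  define l where "l = A_form \<alpha> E x"
  define z where "z = (\<lambda>u. \<bar>x u\<bar>)"
  have z1: "(\<Sum>u\<in>V. (z u)\<^sup>2) = 1" using x by (simp add: z_def)
  have "l \<le> A_form \<alpha> E z" unfolding l_def z_def by (rule A_form_abs[OF \<alpha>])
  moreover have "A_form \<alpha> E z \<le> l" using max[of z] z1 by (simp add: l_def)
  ultimately have "A_form \<alpha> E z = l * (\<Sum>u\<in>V. (z u)\<^sup>2)" using z1 by simp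
  then have eig: "A_act \<alpha> E z u = l * z u" if "u \<in> V" for u
    using A_form_maximizer[OF G, of \<alpha> l z u] max that by (simp add: l_def)
  have zero_nbr: "z v = 0" if "u \<in> V" "z u = 0" "(u, v) \<in> E" for u v
  proof -
    have "(\<Sum>v\<in>E `` {u}. z v) = 0" using eig[OF that(1)] that(2) \<alpha> by (simp add: A_act_def)
    moreover have "\<forall>v\<in>E `` {u}. 0 \<le> z v" by (simp add: z_def)
    ultimately have "\<forall>v\<in>E `` {u}. z v = 0"
      using sum_nonneg_eq_0_iff[of "E `` {u}" z] graph_onD(6)[OF G] by blast
    then show ?thesis using that by auto
  qed
  have pos: "0 < z u" if u: "u \<in> V" for u
  proof (rule ccontr)
    assume "\<not> 0 < z u"
    then have z0: "z u = 0" by (simp add: z_def)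
    have "z v = 0" if "v \<in> V" for v
    proof -
      have "(u, v) \<in> E\<^sup>*" using conn u that by (simp add: connected_on_def)
      then have "v \<in> V \<and> z v = 0"
        by induction (use u z0 zero_nbr graph_onD(8)[OF G] in auto)
      then show ?thesis by simp
    qed
    then show False using z1 by simp
  qed
  show ?thesis
    unfolding perron_pair_def using pos eig max by (auto simp: l_def)
qed

section \<open>Comparison of Perron vectors\<close>

text \<open>The ratio of \<open>y (M - i)\<close> to \<open>y i\<close> decreases in \<open>i\<close> up to the middle, where it crosses 1.\<close>
lemma reflection_le:
  fixes y :: "nat \<Rightarrow> real"
  assumes pos: "\<And>i. i \<le> M \<Longrightarrow> 0 < y i" and b: "0 < b"
    and left0: "0 < M \<Longrightarrow> k0 * y 0 = b * y 1"
    and left: "\<And>i. \<lbrakk>0 < i; 2 * i < M\<rbrakk> \<Longrightarrow> k * y i = b * (y (i - 1) + y (i + 1))"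
    and right0: "0 < M \<Longrightarrow> k0 * y M \<ge> b * y (M - 1)"
    and right: "\<And>i. \<lbrakk>i < M; M < 2 * i\<rbrakk> \<Longrightarrow> k * y i \<ge> b * (y (i - 1) + y (i + 1))"
    and j: "2 * j \<le> M"
  shows "y j \<le> y (M - j)"
proof -
  \<comment> \<open>Monotonicity of the ratio, cross-multiplied. In the induction the recurrence at
    \<open>Suc i\<close> is an equation and the one at \<open>M - Suc i\<close> an inequality;
    multiplied crosswise, their terms in \<open>k\<close> cancel.\<close>
  have W: "y (M - i - 1) * y i \<le> y (M - i) * y (i + 1)" if "2 * i < M" for i
    using that
  proof (induction i)
    case 0
    have "b * (y (M - 1) * y 0) = (b * y (M - 1)) * y 0" by simp
    also have "\<dots> \<le> (k0 * y M) * y 0"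
      using 0 right0 pos[of 0] by (intro mult_right_mono) auto
    also have "\<dots> = b * (y M * y 1)" using left0 0 by simp
    finally show ?case using b by simp
  next
    case (Suc i)
    have m: "M - Suc i < M" "M < 2 * (M - Suc i)" "M - Suc i + 1 = M - i"
      using Suc.prems by auto
    have "b * (y (M - Suc i - 1) * y (Suc i)) = (b * y (M - Suc i - 1)) * y (Suc i)" by simp
    also have "\<dots> \<le> (k * y (M - Suc i) - b * y (M - i)) * y (Suc i)"
      using right[OF m(1,2)] m(3) pos[of "Suc i"] Suc.prems
      by (intro mult_right_mono) (auto simp: algebra_simps)
    also have "\<dots> = y (M - Suc i) * (k * y (Suc i)) - b * (y (M - i) * y (Suc i))"
      by (simp add: algebra_simps)
    also have "k * y (Suc i) = b * (y i + y (Suc i + 1))" using left[of "Suc i"] Suc.prems by simp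
    also have "y (M - Suc i) * (b * (y i + y (Suc i + 1))) - b * (y (M - i) * y (Suc i))
        = b * (y (M - Suc i) * y (Suc i + 1)) + b * (y (M - i - 1) * y i - y (M - i) * y (i + 1))"
      by (simp add: algebra_simps)
    also have "\<dots> \<le> b * (y (M - Suc i) * y (Suc i + 1))"
      using Suc b by (simp add: mult_le_0_iff)
    finally show ?case using b by simp
  qed
  have step: "y i \<le> y (M - i)" if "2 * i < M" "y (i + 1) \<le> y (M - i - 1)" for i
  proof (rule ccontr)
    assume "\<not> y i \<le> y (M - i)"
    then have "y (M - i) * y (i + 1) < y i * y (i + 1)"
      using pos[of "i + 1"] that by (intro mult_strict_right_mono) auto
    also have "\<dots> \<le> y i * y (M - i - 1)"
      using pos[of i] that by (intro mult_left_mono) auto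
    finally show False using W[OF that(1)] by (simp add: mult.commute)
  qed
  \<comment> \<open>The start at the middle: for even \<open>M\<close> both sides coincide, and for
    odd \<open>M\<close> the inequality \<open>W\<close> compares two squares.\<close>
  have mid: "y i \<le> y (M - i)" if "M = 2 * i \<or> M = 2 * i + 1" for i
    using that
  proof
    assume M: "M = 2 * i + 1"
    then have "y i * y i \<le> y (i + 1) * y (i + 1)" using W[of i] by simp
    then have "y i \<le> y (i + 1)"
      using power2_le_imp_le[of "y i" "y (i + 1)"] pos[of "i + 1"] M by (simp add: power2_eq_square)
    then show ?thesis using M by simp
  qed simp
  \<comment> \<open>Here \<open>d\<close> is the distance from the middle, and \<open>step\<close>
    moves the inequality one place outwards. Once \<open>d\<close> reaches \<open>M div 2\<close>,
    truncated subtraction stays at 0 and nothing changes.\<close>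
  have "y (M div 2 - d) \<le> y (M - (M div 2 - d))" for d
  proof (induction d)
    case 0
    have "M = 2 * (M div 2) \<or> M = 2 * (M div 2) + 1" by presburger
    then show ?case using mid by simp
  next
    case (Suc d)
    show ?case
    proof (cases "d < M div 2")
      case True
      then have "M div 2 - Suc d + 1 = M div 2 - d" "M - (M div 2 - Suc d) - 1 = M - (M div 2 - d)"
        by auto
      moreover have "2 * (M div 2 - Suc d) < M" using True by linarith
      ultimately show ?thesis using Suc step[of "M div 2 - Suc d"] by metis
    next
      case False
      then show ?thesis using Suc by simp
    qed
  qed
  from this[of "M div 2 - j"] show ?thesis using j by simp
qed

lemma perron_pair_pos: "perron_pair \<alpha> V E l x \<Longrightarrow> u \<in> V \<Longrightarrow> 0 < x u"
  and perron_pair_act: "perron_pair \<alpha> V E l x \<Longrightarrow> u \<in> V \<Longrightarrow> A_act \<alpha> E x u = l * x u"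
  and perron_pair_form: "perron_pair \<alpha> V E l x \<Longrightarrow> A_form \<alpha> E y \<le> l * (\<Sum>u\<in>V. (y u)\<^sup>2)"
  by (auto simp: perron_pair_def)

lemma perron_pair_form_eq:
  assumes "graph_on V E" "perron_pair \<alpha> V E l x"
  shows "A_form \<alpha> E x = l * (\<Sum>u\<in>V. (x u)\<^sup>2)"
  unfolding A_form_eq[OF assms(1)] sum_distrib_left
  by (rule sum.cong) (use perron_pair_act[OF assms(2)] in \<open>auto simp: power2_eq_square\<close>)

text \<open>Test the form of \<open>E\<close> on the Perron vector of \<open>F\<close>; equality would make it an eigenvector of both.\<close>
lemma perron_less:
  assumes G: "graph_on V E" and H: "graph_on V F"
    and E: "perron_pair \<alpha> V E l x" and F: "perron_pair \<alpha> V F m y"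
    and form: "A_form \<alpha> F y \<le> A_form \<alpha> E y"
    and w: "w \<in> V" "A_act \<alpha> F y w \<noteq> A_act \<alpha> E y w"
  shows "m < l"
proof -
  define s where "s = (\<Sum>u\<in>V. (y u)\<^sup>2)"
  have "0 < (y w)\<^sup>2" using perron_pair_pos[OF F w(1)] by simp
  also have "\<dots> \<le> s" unfolding s_def using w(1) graph_onD(1)[OF G] by (intro member_le_sum) auto
  finally have s: "0 < s" .
  have 1: "m * s = A_form \<alpha> F y" using perron_pair_form_eq[OF H F] by (simp add: s_def)
  also have "\<dots> \<le> A_form \<alpha> E y" by (rule form)
  also have 2: "\<dots> \<le> l * s" using perron_pair_form[OF E] by (simp add: s_def)
  finally have "m \<le> l" using s by simp
  moreover have "m \<noteq> l"
  proof
    assume "m = l"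
    then have "A_form \<alpha> E y = l * (\<Sum>u\<in>V. (y u)\<^sup>2)" using 1 2 form by (simp add: s_def)
    then have "A_act \<alpha> E y w = l * y w"
      by (rule A_form_maximizer[OF G perron_pair_form[OF E] _ w(1)])
    then show False using w perron_pair_act[OF F w(1)] \<open>m = l\<close> by simp
  qed
  ultimately show ?thesis by simp
qed

section \<open>Adding an edge and rotating an edge\<close>

abbreviation edge :: "'a \<Rightarrow> 'a \<Rightarrow> 'a rel" where
  "edge u v \<equiv> {(u, v), (v, u)}"

lemma A_form_insert_edge:
  assumes "finite E" "(u, v) \<notin> E" "(v, u) \<notin> E" "u \<noteq> v"
  shows "A_form \<alpha> (E \<union> edge u v) x =
    A_form \<alpha> E x + \<alpha> * ((x u)\<^sup>2 + (x v)\<^sup>2) + 2 * (1 - \<alpha>) * (x u * x v)"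
  using assms by (simp add: A_form_def algebra_simps)

lemma A_act_insert_edge:
  assumes "finite (E `` {u})" "(u, v) \<notin> E" "u \<noteq> v"
  shows "A_act \<alpha> (E \<union> edge u v) x u = A_act \<alpha> E x u + \<alpha> * x u + (1 - \<alpha>) * x v"
proof -
  have "(E \<union> edge u v) `` {u} = insert v (E `` {u})" using assms by auto
  then show ?thesis using assms by (simp add: A_act_def algebra_simps)
qed

lemma graph_on_edge:
  "graph_on V E \<Longrightarrow> u \<in> V \<Longrightarrow> v \<in> V \<Longrightarrow> u \<noteq> v \<Longrightarrow> graph_on V (E \<union> edge u v)"
  "graph_on V E \<Longrightarrow> graph_on V (E - edge u v)"
  by (auto simp: graph_on_def sym_def irrefl_def)

text \<open>On the positive vector \<open>y\<close> the additional edge raises the form, and it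
  raises the image at \<open>u\<close>, which excludes equality in
  \<open>perron_less\<close>.\<close>

lemma perron_edge_less:
  assumes G: "graph_on V E" and e: "u \<in> V" "v \<in> V" "u \<noteq> v" "(u, v) \<notin> E" and \<alpha>: "0 \<le> \<alpha>" "\<alpha> < 1"
    and E: "perron_pair \<alpha> V (E \<union> edge u v) l x" and F: "perron_pair \<alpha> V E m y"
  shows "m < l"
proof (rule perron_less[OF graph_on_edge(1)[OF G e(1-3)] G E F _ e(1)])
  have pos: "0 < y u" "0 < y v" using perron_pair_pos[OF F] e by auto
  have "(v, u) \<notin> E" using graph_onD(4)[OF G, of v u] e by auto
  then show "A_form \<alpha> E y \<le> A_form \<alpha> (E \<union> edge u v) y"
    using pos \<alpha> e graph_onD(2)[OF G] by (subst A_form_insert_edge) auto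
  have "0 < \<alpha> * y u + (1 - \<alpha>) * y v" using pos \<alpha> by (simp add: add_nonneg_pos)
  then show "A_act \<alpha> E y u \<noteq> A_act \<alpha> (E \<union> edge u v) y u"
    using e graph_onD(6)[OF G] by (subst A_act_insert_edge) auto
qed

text \<open>The test vector \<open>y\<close> belongs to the graph with the edge \<open>w u\<close>.
  Since its entry at \<open>v\<close> is at least the one at \<open>w\<close>, moving the edge to
  \<open>v\<close> does not lower the form, and the loss of a neighbour changes the image at
  \<open>w\<close>.\<close>

lemma perron_rotate_less:
  assumes G: "graph_on V E" and V: "u \<in> V" "v \<in> V" "w \<in> V" "u \<noteq> v" "u \<noteq> w" "v \<noteq> w"
    and e: "(v, u) \<notin> E" "(w, u) \<notin> E" and \<alpha>: "0 \<le> \<alpha>" "\<alpha> < 1"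
    and E: "perron_pair \<alpha> V (E \<union> edge v u) l x" and F: "perron_pair \<alpha> V (E \<union> edge w u) m y"
    and le: "y w \<le> y v"
  shows "m < l"
proof (rule perron_less[OF _ _ E F _ V(3)])
  show "graph_on V (E \<union> edge v u)" "graph_on V (E \<union> edge w u)"
    using graph_on_edge[OF G] V by auto
  have pos: "0 < y u" "0 < y v" "0 < y w" using perron_pair_pos[OF F] V by auto
  have e': "(u, v) \<notin> E" "(u, w) \<notin> E" using graph_onD(4)[OF G] e by blast+
  have "(y w)\<^sup>2 \<le> (y v)\<^sup>2" using le pos by (intro power_mono) auto
  then have "\<alpha> * ((y w)\<^sup>2 + (y u)\<^sup>2) \<le> \<alpha> * ((y v)\<^sup>2 + (y u)\<^sup>2)"
    using \<alpha> by (intro mult_left_mono) auto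
  moreover have "2 * (1 - \<alpha>) * (y w * y u) \<le> 2 * (1 - \<alpha>) * (y v * y u)"
    using \<alpha> le pos by (intro mult_left_mono mult_right_mono) auto
  ultimately show "A_form \<alpha> (E \<union> edge w u) y \<le> A_form \<alpha> (E \<union> edge v u) y"
    using A_form_insert_edge[OF graph_onD(2)[OF G] e(1) e'(1), of \<alpha> y]
      A_form_insert_edge[OF graph_onD(2)[OF G] e(2) e'(2), of \<alpha> y] V by (simp add: add.commute)
  have "0 < \<alpha> * y w + (1 - \<alpha>) * y u" using pos \<alpha> by (simp add: add_nonneg_pos)
  moreover have "A_act \<alpha> (E \<union> edge v u) y w = A_act \<alpha> E y w"
  proof -
    have "(E \<union> edge v u) `` {w} = E `` {w}" using V by auto
    then show ?thesis by (simp add: A_act_def)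
  qed
  ultimately show "A_act \<alpha> (E \<union> edge w u) y w \<noteq> A_act \<alpha> (E \<union> edge v u) y w"
    using A_act_insert_edge[OF graph_onD(6)[OF G] e(2), of \<alpha> y] V by simp
qed

text \<open>Further neighbours only add nonnegative terms. This serves at path vertices from which
  other branches may leave.\<close>

lemma A_act_ge:
  assumes G: "graph_on V E" and y: "\<And>u. u \<in> V \<Longrightarrow> 0 \<le> y u" and \<alpha>: "0 \<le> \<alpha>" "\<alpha> < 1"
    and N: "N \<subseteq> E `` {u}" and u: "u \<in> V"
  shows "\<alpha> * real (card N) * y u + (1 - \<alpha>) * sum y N \<le> A_act \<alpha> E y u"
proof -
  have fin: "finite (E `` {u})" by (rule graph_onD(6)[OF G])
  have "\<alpha> * real (card N) * y u \<le> \<alpha> * real (card (E `` {u})) * y u"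
    using \<alpha> y u card_mono[OF fin N] by (intro mult_right_mono mult_left_mono) auto
  moreover have "sum y N \<le> sum y (E `` {u})"
    using N y graph_onD(8)[OF G] by (intro sum_mono2[OF fin]) auto
  then have "(1 - \<alpha>) * sum y N \<le> (1 - \<alpha>) * sum y (E `` {u})" using \<alpha> by (intro mult_left_mono) auto
  ultimately show ?thesis by (simp add: A_act_def)
qed

text \<open>Along \<open>Z\<close> the eigenvalue equation is the recurrence of
  \<open>reflection_le\<close>, with coefficient \<open>l - \<alpha>\<close> at an end and
  \<open>l - 2 * \<alpha>\<close> inside. In the first half the degree bounds leave only path
  neighbours, which gives equations; in the second half other neighbours may exist, which gives
  inequalities.\<close>

lemma perron_path_reflect:
  assumes G: "graph_on V E" and F: "perron_pair \<alpha> V E l y" and \<alpha>: "0 \<le> \<alpha>" "\<alpha> < 1"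
    and Z: "vpath E Z" "set Z \<subseteq> V" and M: "M < length Z" and j: "2 * j \<le> M"
    and leaf: "card (E `` {Z ! 0}) \<le> 1"
    and deg: "\<And>i. 2 * i < M \<Longrightarrow> card (E `` {Z ! i}) \<le> 2"
  shows "y (Z ! j) \<le> y (Z ! (M - j))"
proof -
  have ZV: "Z ! i \<in> V" if "i \<le> M" for i using that Z M by auto
  have adj: "(Z ! i, Z ! Suc i) \<in> E" "(Z ! Suc i, Z ! i) \<in> E" if "i < M" for i
  proof -
    show "(Z ! i, Z ! Suc i) \<in> E"
      using Z that M by (intro successively_nth[of "\<lambda>u v. (u, v) \<in> E"]) (auto simp: vpath_def)
    then show "(Z ! Suc i, Z ! i) \<in> E" by (rule graph_onD(4)[OF G])
  qed
  have ne: "Z ! (i - 1) \<noteq> Z ! (i + 1)" if "i < M" for i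
    using Z that M by (auto simp: vpath_def nth_eq_iff_index_eq)
  have pos: "0 < y (Z ! i)" if "i \<le> M" for i using perron_pair_pos[OF F ZV[OF that]] .
  have act: "A_act \<alpha> E y (Z ! i) = l * y (Z ! i)" if "i \<le> M" for i
    using perron_pair_act[OF F ZV[OF that]] .
  have nonneg: "\<And>u. u \<in> V \<Longrightarrow> 0 \<le> y u" using perron_pair_pos[OF F] less_imp_le by blast
  have sub2: "{Z ! (i - 1), Z ! (i + 1)} \<subseteq> E `` {Z ! i}" if "0 < i" "i < M" for i
    using adj(2)[of "i - 1"] adj(1)[of i] that by auto
  define f where "f = (\<lambda>i. y (Z ! i))"
  have "f j \<le> f (M - j)"
  proof (rule reflection_le[of M f "1 - \<alpha>" "l - \<alpha>" "l - 2 * \<alpha>"])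
    assume "0 < M"
    have "E `` {Z ! 0} = {Z ! 1}"
      using leaf adj(1)[of 0] \<open>0 < M\<close> card_seteq[of "E `` {Z ! 0}" "{Z ! 1}"] graph_onD(6)[OF G]
      by auto
    then show "(l - \<alpha>) * f 0 = (1 - \<alpha>) * f 1"
      using act[of 0] by (simp add: A_act_def f_def algebra_simps)
    have "{Z ! (M - 1)} \<subseteq> E `` {Z ! M}" using adj(2)[of "M - 1"] \<open>0 < M\<close> by auto
    from A_act_ge[where y = y, OF G nonneg \<alpha> this ZV] show "(1 - \<alpha>) * f (M - 1) \<le> (l - \<alpha>) * f M"
      using act[of M] by (simp add: f_def algebra_simps)
  next
    fix i assume i: "0 < i" "2 * i < M"
    then have "E `` {Z ! i} = {Z ! (i - 1), Z ! (i + 1)}"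
      using sub2[of i] deg[of i] ne[of i] graph_onD(6)[OF G]
      by (intro card_seteq[symmetric]) auto
    then show "(l - 2 * \<alpha>) * f i = (1 - \<alpha>) * (f (i - 1) + f (i + 1))"
      using act[of i] ne[of i] i by (simp add: A_act_def f_def algebra_simps)
  next
    fix i assume i: "i < M" "M < 2 * i"
    from A_act_ge[where y = y, OF G nonneg \<alpha> sub2 ZV, of i] i
    show "(1 - \<alpha>) * (f (i - 1) + f (i + 1)) \<le> (l - 2 * \<alpha>) * f i"
      using act[of i] ne[of i] by (simp add: f_def algebra_simps)
  qed (use pos \<alpha> j in \<open>auto simp: f_def\<close>)
  then show ?thesis by (simp add: f_def)
qed

section \<open>Moving a pendant path\<close>

text \<open>Take a longest continuation \<open>as\<close> of the path through \<open>a\<close>. A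
  vertex of degree at least 3 on it would end a path longer than \<open>max\<close> permits. A
  second neighbour of its last vertex would, by acyclicity, prolong it. So \<open>as\<close> is a
  pendant path whose neighbourhood stays in \<open>v # as\<close>.\<close>

lemma pendant_branch_ex:
  assumes G: "graph_on V E" and acyc: "acyclic_graph E"
    and P: "vpath E (us @ [v])" "us \<noteq> []"
    and max: "\<And>q. \<lbrakk>vpath E q; q \<noteq> []; 3 \<le> card (E `` {last q})\<rbrakk> \<Longrightarrow> length q \<le> length (us @ [v])"
    and a: "(v, a) \<in> E" "a \<noteq> last us"
  shows "\<exists>as. as \<noteq> [] \<and> hd as = a \<and> vpath E (us @ v # as) \<and> card (E `` {last as}) \<le> 1 \<and>
    (\<forall>z\<in>set as. card (E `` {z}) \<le> 2 \<and> E `` {z} \<subseteq> set (v # as))"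
proof -
  define Q where "Q = (\<lambda>as. as \<noteq> [] \<and> hd as = a \<and> vpath E (us @ v # as))"
  obtain us' x where "us = us' @ [x]" using P(2) by (metis rev_exhaust)
  then have "a \<notin> set (us @ [v])"
    using acyclic_nbr_notin[OF G acyc, of us' x v a] P a by simp
  then have "Q [a]" using P a by (auto simp: Q_def vpath_append vpath_Cons)
  moreover have "distinct as \<and> set as \<subseteq> V" if "Q as" for as
    using vpath_subset[OF G, of "us @ v # as"] that P(2) by (simp add: Q_def vpath_def)
  ultimately obtain as where as: "Q as" and longest: "\<And>bs. Q bs \<Longrightarrow> length bs \<le> length as"
    using longest_path_ex[of V Q "[a]"] graph_onD(1)[OF G] by blast
  have path: "vpath E (us @ v # as)" and ne: "as \<noteq> []" using as by (auto simp: Q_def)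
  have deg: "card (E `` {z}) \<le> 2" if "z \<in> set as" for z
  proof (rule ccontr)
    assume "\<not> card (E `` {z}) \<le> 2"
    obtain a1 a2 where "as = a1 @ z # a2" using \<open>z \<in> set as\<close> by (meson split_list)
    then have "vpath E (us @ v # a1 @ [z])"
      using path vpath_append[of E "us @ v # a1 @ [z]" a2] by simp
    then show False using max[of "us @ v # a1 @ [z]"] \<open>\<not> card (E `` {z}) \<le> 2\<close> by simp
  qed
  \<comment> \<open>\<open>x\<close> is the vertex before the end \<open>y\<close>; it is
    \<open>v\<close> itself if \<open>as\<close> has only one vertex.\<close>
  define x y where "x = last (v # butlast as)" and "y = last as"
  have "v # as = (v # butlast as) @ [y]" using ne by (simp add: y_def)
  also have "v # butlast as = butlast (v # butlast as) @ [x]"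
    unfolding x_def by (rule append_butlast_last_id[symmetric]) simp
  finally have xy: "us @ v # as = (us @ butlast (v # butlast as)) @ [x, y]" by simp
  have end_sub: "E `` {y} \<subseteq> {x}"
  proof (rule ccontr)
    assume "\<not> E `` {y} \<subseteq> {x}"
    then obtain z where z: "(y, z) \<in> E" "z \<noteq> x" by auto
    then have "z \<notin> set (us @ v # as)"
      using acyclic_nbr_notin[OF G acyc, of "us @ butlast (v # butlast as)" x y z] path
      unfolding xy by blast
    then have "Q (as @ [z])"
      using as z by (auto simp: Q_def y_def vpath_append vpath_Cons)
    then show False using longest by fastforce
  qed
  then have "card (E `` {y}) \<le> card {x}" by (intro card_mono) auto
  then have leaf: "card (E `` {last as}) \<le> 1" by (simp add: y_def)
  have "E `` {z} \<subseteq> set (v # as)" if "z \<in> set as" for z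
  proof -
    obtain a1 a2 where a12: "as = a1 @ z # a2" using \<open>z \<in> set as\<close> by (meson split_list)
    show ?thesis
    proof (cases a2)
      case Nil
      then have "z = y" "x \<in> set (v # as)" using a12 by (auto simp: y_def x_def)
      then show ?thesis using end_sub by blast
    next
      case (Cons c a3)
      define d where "d = last (v # a1)"
      have "(d, z) \<in> E" "(z, c) \<in> E" "d \<noteq> c" "d \<in> set (v # as)" "c \<in> set as"
        using path unfolding a12 Cons d_def by (auto simp: vpath_append vpath_Cons)
      moreover from this have "{d, c} = E `` {z}"
        using deg[OF \<open>z \<in> set as\<close>] graph_onD(4)[OF G, of d z] graph_onD(6)[OF G, of z]
        by (intro card_seteq) auto
      ultimately show ?thesis by auto
    qed
  qed
  then show ?thesis using as leaf deg by (auto simp: Q_def)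
qed

text \<open>Take a longest path that ends at a vertex \<open>v\<close> of degree at least 3;
  \<open>us\<close> is its remainder, with the neighbour of \<open>v\<close> last. Besides
  \<open>last us\<close> there are two neighbours of \<open>v\<close>, each starting a pendant path.
  One of these, reversed and ended by \<open>v\<close>, competes with the longest path, whence the
  bound on \<open>length bs\<close>.\<close>

lemma pendant_branches_ex:
  assumes G: "graph_on V E" and acyc: "acyclic_graph E" and branch: "3 \<le> card (E `` {c})"
  shows "\<exists>us v as bs. us \<noteq> [] \<and> as \<noteq> [] \<and> bs \<noteq> [] \<and> length bs \<le> length us \<and>
    vpath E (us @ v # as) \<and> vpath E (us @ v # bs) \<and> set as \<inter> set bs = {} \<and>
    card (E `` {last bs}) \<le> 1 \<and> card (E `` {last as}) \<le> 1 \<and>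
    (\<forall>z\<in>set as. card (E `` {z}) \<le> 2 \<and> E `` {z} \<subseteq> set (v # as)) \<and>
    (\<forall>z\<in>set bs. card (E `` {z}) \<le> 2)"
proof -
  define R where "R = (\<lambda>p. p \<noteq> [] \<and> vpath E p \<and> 3 \<le> card (E `` {last p}))"
  have R_V: "distinct p \<and> set p \<subseteq> V" if "R p" for p
  proof -
    have "E `` {last p} \<noteq> {}" using that by (auto simp: R_def)
    then have "last p \<in> V" using graph_onD(3)[OF G] by auto
    then show ?thesis
      using vpath_subset[OF G, of p] that by (cases "length p = 1") (auto simp: R_def vpath_def length_Suc_conv)
  qed
  have "R [c]" using branch by (simp add: R_def vpath_Cons)
  then obtain p where p: "R p" and longest: "\<And>q. R q \<Longrightarrow> length q \<le> length p"
    using longest_path_ex[of V R "[c]"] R_V graph_onD(1)[OF G] by blast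
  obtain us v where usv: "p = us @ [v]" using p by (metis R_def rev_exhaust)
  have P: "vpath E (us @ [v])" and v3: "3 \<le> card (E `` {v})" using p usv by (auto simp: R_def)
  have max: "length q \<le> length (us @ [v])" if "vpath E q" "q \<noteq> []" "3 \<le> card (E `` {last q})" for q
    using longest[of q] that usv by (simp add: R_def)
  have fin: "finite (E `` {v})" by (rule graph_onD(6)[OF G])
  have "us \<noteq> []"
  proof
    assume "us = []"
    have "E `` {v} \<noteq> {}" using v3 by auto
    then obtain a where "(v, a) \<in> E" by auto
    then have "vpath E [a, v]" using graph_onD(4,5)[OF G] by (auto simp: vpath_Cons)
    then show False using max[of "[a, v]"] v3 \<open>us = []\<close> by simp
  qed
  have "card (E `` {v} - {last us}) \<ge> 2"
    using v3 by (cases "(v, last us) \<in> E") (auto simp: card_Diff_singleton_if)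
  then obtain T where T: "T \<subseteq> E `` {v} - {last us}" "card T = 2"
    by (rule obtain_subset_with_card_n)
  then obtain a b where ab: "(v, a) \<in> E" "(v, b) \<in> E" "a \<noteq> last us" "b \<noteq> last us" "a \<noteq> b"
    unfolding card_2_iff by auto
  obtain as where as: "as \<noteq> []" "hd as = a" "vpath E (us @ v # as)" "card (E `` {last as}) \<le> 1"
    "\<And>z. z \<in> set as \<Longrightarrow> card (E `` {z}) \<le> 2 \<and> E `` {z} \<subseteq> set (v # as)"
    using pendant_branch_ex[OF G acyc P \<open>us \<noteq> []\<close> max ab(1,3)] by blast
  obtain bs where bs: "bs \<noteq> []" "hd bs = b" "vpath E (us @ v # bs)" "card (E `` {last bs}) \<le> 1"
    "\<And>z. z \<in> set bs \<Longrightarrow> card (E `` {z}) \<le> 2"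
    using pendant_branch_ex[OF G acyc P \<open>us \<noteq> []\<close> max ab(2,4)] by blast
  have "vpath E (v # bs)" using bs(3) by (simp add: vpath_append)
  then have "vpath E (rev bs @ [v])" using vpath_rev[OF G, of "v # bs"] by simp
  then have len: "length bs \<le> length us" using max[of "rev bs @ [v]"] v3 by simp
  \<comment> \<open>Let \<open>z\<close> be the first vertex of \<open>bs\<close> on
    \<open>as\<close>. A predecessor of \<open>z\<close> in \<open>bs\<close> would be a neighbour
    of \<open>z\<close> outside \<open>v # as\<close>. If instead \<open>z = b\<close>, then
    \<open>as\<close> leads from \<open>a\<close> to a second neighbour of \<open>v\<close> and
    closes a cycle.\<close>
  have "set as \<inter> set bs = {}"
  proof (rule ccontr)
    assume "set as \<inter> set bs \<noteq> {}"
    then obtain b1 z b2 where z: "bs = b1 @ z # b2" "z \<in> set as" "\<forall>x\<in>set b1. x \<notin> set as"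
      using split_list_first_prop[of bs "\<lambda>x. x \<in> set as"] by blast
    show False
    proof (cases "b1 = []")
      case False
      then have "(last b1, z) \<in> E" "last b1 \<noteq> v" "last b1 \<in> set b1"
        using bs(3) z by (auto simp: vpath_append vpath_Cons)
      then show False using as(5)[OF z(2)] z(3) graph_onD(4)[OF G] by fastforce
    next
      case True
      then have "z = b" using bs z by simp
      obtain a1 a2 where a12: "as = a1 @ z # a2" using z by (meson split_list)
      then have "a1 \<noteq> []" using as ab \<open>z = b\<close> by auto
      have "vpath E (v # a1 @ [z])"
        using as(3) a12 vpath_append[of E us "v # as"] vpath_append[of E "v # a1 @ [z]" a2] by simp
      moreover have "3 \<le> length (v # a1 @ [z])" using \<open>a1 \<noteq> []\<close> by (cases a1) auto
      moreover have "(last (v # a1 @ [z]), hd (v # a1 @ [z])) \<in> E"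
        using ab \<open>z = b\<close> graph_onD(4)[OF G] by auto
      ultimately show False using acyc unfolding acyclic_graph_def by blast
    qed
  qed
  then show ?thesis
    using \<open>us \<noteq> []\<close> as bs len by blast
qed

lemma connected_on_subset_rtrancl:
  "connected_on V E \<Longrightarrow> E \<subseteq> F\<^sup>* \<Longrightarrow> connected_on V F"
  unfolding connected_on_def using rtrancl_subset_rtrancl by blast

text \<open>With \<open>w = last as\<close> and \<open>b = hd bs\<close>, \<open>F\<close> trades
  the edge \<open>v b\<close> for \<open>w b\<close>, so that \<open>us\<close>, \<open>v\<close>,
  \<open>as\<close>, \<open>bs\<close> form one path. The inclusion of \<open>F\<close> in the
  conclusion serves to bound the loss in the dissociation number.\<close>

lemma rotation_ex:
  assumes G: "graph_on V E" and conn: "connected_on V E" and acyc: "acyclic_graph E"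
    and branch: "3 \<le> card (E `` {c})" and \<alpha>: "0 \<le> \<alpha>" "\<alpha> < 1" and E: "perron_pair \<alpha> V E l x"
  shows "\<exists>F w b. graph_on V F \<and> connected_on V F \<and> F \<subseteq> E \<union> edge w b \<and>
    (\<forall>m y. perron_pair \<alpha> V F m y \<longrightarrow> m < l)"
proof -
  obtain us v as bs where ne: "us \<noteq> []" "as \<noteq> []" "bs \<noteq> []" and len: "length bs \<le> length us"
    and as: "vpath E (us @ v # as)" and bs: "vpath E (us @ v # bs)" and disj: "set as \<inter> set bs = {}"
    and leafb: "card (E `` {last bs}) \<le> 1" and leafa: "card (E `` {last as}) \<le> 1"
    and dega: "\<And>z. z \<in> set as \<Longrightarrow> card (E `` {z}) \<le> 2 \<and> E `` {z} \<subseteq> set (v # as)"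
    and degb: "\<And>z. z \<in> set bs \<Longrightarrow> card (E `` {z}) \<le> 2"
    using pendant_branches_ex[OF G acyc branch] by blast
  define w b where "w = last as" and "b = hd bs"
  have w: "w \<in> set as" and b: "b \<in> set bs" using ne by (auto simp: w_def b_def)
  have v: "v \<notin> set as" "v \<notin> set bs" using as bs by (auto simp: vpath_append vpath_Cons)
  have vb: "(v, b) \<in> E" "(b, v) \<in> E"
  proof -
    show "(v, b) \<in> E" using bs ne by (auto simp: vpath_append vpath_Cons b_def)
    then show "(b, v) \<in> E" by (rule graph_onD(4)[OF G])
  qed
  have neq: "b \<noteq> v" "b \<noteq> w" "v \<noteq> w" using v w b disj by auto
  have wb: "(w, b) \<notin> E" using dega[OF w] neq disj b by auto
  have inV: "set (us @ v # as) \<subseteq> V" "set (us @ v # bs) \<subseteq> V"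
    using vpath_subset[OF G as] vpath_subset[OF G bs] ne by auto
  then have V: "b \<in> V" "v \<in> V" "w \<in> V" using w b by auto
  define D F where "D = E - edge v b" and "F = D \<union> edge w b"
  have D: "graph_on V D" unfolding D_def by (rule graph_on_edge(2)[OF G])
  have F: "graph_on V F" unfolding F_def by (rule graph_on_edge(1)[OF D V(3,1) neq(2)[symmetric]])
  have ED: "E = D \<union> edge v b" using vb by (auto simp: D_def)
  have path1: "vpath F (us @ v # as)"
  proof (rule vpath_mono[OF as])
    fix s t assume "s \<in> set (us @ v # as)" "t \<in> set (us @ v # as)" "(s, t) \<in> E"
    moreover have "b \<notin> set (us @ v # as)"
      using bs b disj neq by (auto simp: vpath_append)
    ultimately show "(s, t) \<in> F" by (auto simp: F_def D_def)
  qed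
  have path2: "vpath F bs"
    by (rule vpath_mono[of E]) (use bs v in \<open>auto simp: vpath_append vpath_Cons F_def D_def\<close>)
  have path: "vpath F (us @ v # as @ bs)"
    using path1 path2 disj bs ne
    by (auto simp: vpath_append vpath_Cons F_def w_def b_def)
  have connF: "connected_on V F"
  proof (rule connected_on_subset_rtrancl[OF conn])
    have "vpath F (v # as)" using path1 by (simp add: vpath_append)
    then have "(v, w) \<in> F\<^sup>*" using vpath_rtrancl[of F "v # as" w] w by simp
    moreover have "(w, b) \<in> F" by (simp add: F_def)
    ultimately have "(v, b) \<in> F\<^sup>*" by (rule rtrancl_into_rtrancl)
    moreover have "sym (F\<^sup>*)" using F by (simp add: graph_on_def sym_rtrancl)
    ultimately have "(b, v) \<in> F\<^sup>*" by (simp add: symD)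
    then show "E \<subseteq> F\<^sup>*" using \<open>(v, b) \<in> F\<^sup>*\<close> by (auto simp: ED F_def)
  qed
  \<comment> \<open>At \<open>b\<close> the neighbour \<open>v\<close> is exchanged for
    \<open>w\<close>, so no degree on \<open>bs\<close> grows. On \<open>as\<close> only the former
    leaf \<open>w\<close> gains a neighbour.\<close>
  have cardb: "card (F `` {z}) \<le> card (E `` {z})" if "z \<in> set bs" for z
  proof (cases "z = b")
    case True
    have "F `` {b} = insert w (E `` {b} - {v})" using neq by (auto simp: F_def D_def)
    then have "card (F `` {b}) \<le> Suc (card (E `` {b} - {v}))" by (simp add: card_insert_le_m1)
    also have "\<dots> = card (E `` {b})" using vb by (intro card_Suc_Diff1 graph_onD(6)[OF G]) auto
    finally show ?thesis using True by simp
  next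
    case False
    then have "F `` {z} = E `` {z}" using that v w disj by (auto simp: F_def D_def)
    then show ?thesis by simp
  qed
  have carda: "card (F `` {z}) \<le> 2" if "z \<in> set as" for z
  proof (cases "z = w")
    case True
    have "F `` {w} = insert b (E `` {w})" using neq by (auto simp: F_def D_def)
    then show ?thesis using leafa graph_onD(6)[OF G] True by (auto simp: w_def card_insert_if)
  next
    case False
    then have "F `` {z} = E `` {z}" using that v b disj by (auto simp: F_def D_def)
    then show ?thesis using dega[OF that] by simp
  qed
  have "m < l" if y: "perron_pair \<alpha> V F m y" for m y
  proof (rule perron_rotate_less[OF D V neq _ _ \<alpha> E[unfolded ED] y[unfolded F_def]])
    show "(v, b) \<notin> D" "(w, b) \<notin> D" using wb by (auto simp: D_def)
    \<comment> \<open>Read from the free end of \<open>bs\<close>, \<open>w\<close> has position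
      \<open>length bs\<close> and \<open>v\<close> has position
      \<open>length bs + length as\<close>; their sum is \<open>M\<close>, so the reflection
      exchanges them. \<open>M < length Z\<close> is exactly
      \<open>length bs \<le> length us\<close>, and the positions below \<open>M / 2\<close> lie on
      \<open>bs\<close> or \<open>as\<close>.\<close>
    define Z where "Z = rev bs @ rev as @ v # rev us"
    define M where "M = length as + 2 * length bs"
    have "Z = rev (us @ v # as @ bs)" by (simp add: Z_def)
    then have "vpath F Z" using path vpath_rev[OF F] by metis
    moreover have "set Z \<subseteq> V" using inV by (auto simp: Z_def)
    moreover have "M < length Z" using len by (simp add: Z_def M_def)
    moreover have "2 * length bs \<le> M" by (simp add: M_def)
    moreover have "Z ! 0 = last bs" using ne by (simp add: Z_def nth_append rev_nth last_conv_nth)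
    then have "card (F `` {Z ! 0}) \<le> 1" using cardb[of "last bs"] leafb ne by simp
    moreover have "card (F `` {Z ! i}) \<le> 2" if "2 * i < M" for i
    proof -
      have "i < length (rev bs @ rev as)" using that by (simp add: M_def)
      then have "Z ! i = (rev bs @ rev as) ! i" unfolding Z_def by (metis append_assoc nth_append)
      then have "Z ! i \<in> set (rev bs @ rev as)" using \<open>i < length (rev bs @ rev as)\<close> by (metis nth_mem)
      then show ?thesis using carda cardb degb by fastforce
    qed
    ultimately have "y (Z ! length bs) \<le> y (Z ! (M - length bs))"
      by (rule perron_path_reflect[OF F y \<alpha>])
    moreover have "Z ! length bs = w" using ne by (simp add: Z_def nth_append rev_nth w_def last_conv_nth)
    moreover have "Z ! (M - length bs) = v" by (simp add: Z_def M_def nth_append)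
    ultimately show "y w \<le> y v" by simp
  qed
  then show ?thesis using F connF by (intro exI[of _ F] exI[of _ w] exI[of _ b]) (auto simp: F_def D_def)
qed

section \<open>Deleting a cycle edge, and dissociation sets under a new edge\<close>

text \<open>Remove the closing edge of a cycle: the rest of the cycle is a path that still joins its
  ends, so connectedness survives.\<close>

lemma cycle_edge_ex:
  assumes G: "graph_on V E" and conn: "connected_on V E" and "\<not> acyclic_graph E"
  shows "\<exists>F u v. graph_on V F \<and> connected_on V F \<and> E = F \<union> edge u v \<and>
    (u, v) \<notin> F \<and> u \<in> V \<and> v \<in> V \<and> u \<noteq> v"
proof -
  obtain p where p: "vpath E p" "3 \<le> length p" "(last p, hd p) \<in> E"
    using assms(3) by (auto simp: acyclic_graph_def)
  define u v where "u = last p" and "v = hd p"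
  define F where "F = E - edge u v"
  have uv: "(u, v) \<in> E" "(v, u) \<in> E" using p graph_onD(4)[OF G] by (auto simp: u_def v_def)
  have F: "graph_on V F" unfolding F_def by (rule graph_on_edge(2)[OF G])
  have nth: "u = p ! (length p - 1)" "v = p ! 0"
    using p(2) last_conv_nth[of p] hd_conv_nth[of p] by (force simp: u_def v_def)+
  have "vpath F p"
    unfolding vpath_def successively_conv_nth
  proof (intro conjI allI impI)
    show dist: "distinct p" using p by (simp add: vpath_def)
    fix i assume i: "Suc i < length p"
    then have "(p ! i, p ! Suc i) \<in> E"
      using p(1) by (auto simp: vpath_def successively_conv_nth)
    moreover have "p ! i \<noteq> u"
      using i nth_eq_iff_index_eq[OF dist, of i "length p - 1"] unfolding nth by simp
    \<comment> \<open>Going from the first vertex to the last in one step would need a path of two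
      vertices.\<close>
    moreover have "p ! i \<noteq> v \<or> p ! Suc i \<noteq> u"
    proof (rule disjCI)
      assume "\<not> p ! Suc i \<noteq> u"
      then have "Suc i = length p - 1"
        using i nth_eq_iff_index_eq[OF dist, of "Suc i" "length p - 1"] unfolding nth by simp
      then have "i \<noteq> 0" using p(2) by linarith
      then show "p ! i \<noteq> v"
        using i nth_eq_iff_index_eq[OF dist, of i 0] unfolding nth by (cases p) auto
    qed
    ultimately show "(p ! i, p ! Suc i) \<in> F" by (auto simp: F_def)
  qed
  moreover have "u \<in> set p" unfolding u_def using p(2) by (intro last_in_set) auto
  ultimately have "(v, u) \<in> F\<^sup>*" using vpath_rtrancl[of F p u] by (simp add: v_def)
  moreover from this have "(u, v) \<in> F\<^sup>*"
    using F sym_rtrancl[of F] by (simp add: graph_on_def sym_def)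
  ultimately have "E \<subseteq> F\<^sup>*" by (auto simp: F_def)
  then have "connected_on V F" by (rule connected_on_subset_rtrancl[OF conn])
  moreover have "E = F \<union> edge u v" using uv by (auto simp: F_def)
  moreover have "(u, v) \<notin> F" by (simp add: F_def)
  moreover have "u \<noteq> v" using uv graph_onD(5)[OF G] by blast
  moreover have "u \<in> V" "v \<in> V" using uv graph_onD(7)[OF G] by blast+
  ultimately show ?thesis using F by blast
qed

text \<open>Without \<open>b\<close> the new edge has an end outside the set, so no vertex gains a
  neighbour in it. The cost is at most one vertex.\<close>

lemma dissoc_add_edge:
  assumes "dissoc E S" "F \<subseteq> E \<union> edge w b" "finite S"
  shows "dissoc F (S - {b})"
  unfolding dissoc_def
proof
  fix v assume v: "v \<in> S - {b}"
  have "card ((S - {b}) \<inter> F `` {v}) \<le> card (S \<inter> E `` {v})"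
    using assms v by (intro card_mono) auto
  also have "\<dots> \<le> 1" using assms v by (auto simp: dissoc_def)
  finally show "card ((S - {b}) \<inter> F `` {v}) \<le> 1" .
qed

section \<open>Matrices and minimisers of the index\<close>

lemma pair_graph_iff: "pair_graph G \<longleftrightarrow> graph_on (pverts G) (parcs G)"
proof
  assume "pair_graph G"
  then interpret pair_graph G .
  show "graph_on (pverts G) (parcs G)"
    unfolding graph_on_def
  proof (intro conjI)
    show "parcs G \<subseteq> pverts G \<times> pverts G" using in_arcsD1 in_arcsD2 by auto
    show "sym (parcs G)" using arcs_symmetric by (simp add: sym_def)
    show "irrefl (parcs G)" using no_loops' by (auto simp: irrefl_def)
  qed (rule pair_finite_verts)
next
  assume G: "graph_on (pverts G) (parcs G)"
  show "pair_graph G"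
  proof
    show "symmetric (with_proj G)" using G by (simp add: graph_on_def symmetric_def)
    show "fst e \<noteq> snd e" if "e \<in> parcs G" for e
      using that graph_onD(5)[OF G] by (cases e) auto
  qed (use graph_onD(1-3)[OF G] in auto)
qed

text \<open>Connectedness in the library uses paths in the symmetric closure restricted to the
  vertex set. On a graph the closure is the relation itself, and paths from a vertex never leave the
  vertex set.\<close>

lemma connected_graph_iff:
  "connected_graph G \<longleftrightarrow>
     graph_on (pverts G) (parcs G) \<and> pverts G \<noteq> {} \<and> connected_on (pverts G) (parcs G)"
proof -
  have "(u, v) \<in> rtrancl_on (pverts G) ((parcs G)\<^sup>s) \<longleftrightarrow> (u, v) \<in> (parcs G)\<^sup>*"
    if G: "graph_on (pverts G) (parcs G)" and u: "u \<in> pverts G" for u v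
  proof -
    have s: "(parcs G)\<^sup>s = parcs G" using graph_onD(4)[OF G] by (auto simp: symcl_def)
    show ?thesis
      unfolding s
    proof
      assume "(u, v) \<in> (parcs G)\<^sup>*"
      then show "(u, v) \<in> rtrancl_on (pverts G) (parcs G)"
      proof induction
        case base
        show ?case using u by simp
      next
        case (step v w)
        then show ?case using graph_onD(8)[OF G] by (blast intro: rtrancl_on_into_rtrancl_on)
      qed
    qed (rule rtrancl_on_rtranclI)
  qed
  then show ?thesis
    unfolding connected_graph_def pair_graph_iff connected_conv connected_on_def by auto
qed

text \<open>Out-degrees count arcs and \<open>dissoc\<close> counts neighbours. The predicate
  \<open>P\<close> accounts for the arcs kept by an induced subgraph.\<close>

lemma card_arcs_from:
  "card {e. e \<in> E \<and> P e \<and> fst e = v} = card {w. (v, w) \<in> E \<and> P (v, w)}"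
  by (rule bij_betw_same_card[of snd]) (auto simp: bij_betw_def inj_on_def image_iff)

lemma out_degree_with_proj: "out_degree (with_proj G) v = card (parcs G `` {v})"
  using card_arcs_from[of "parcs G" "\<lambda>_. True" v]
  by (simp add: out_degree_def out_arcs_def Image_singleton)

lemma dissociation_set_iff:
  "dissociation_set G S \<longleftrightarrow> S \<subseteq> pverts G \<and> dissoc (parcs G) S"
proof -
  have "out_degree (induce_subgraph (with_proj G) S) v = card (S \<inter> parcs G `` {v})" if "v \<in> S" for v
  proof -
    have "{w. (v, w) \<in> parcs G \<and> v \<in> S \<and> w \<in> S} = S \<inter> parcs G `` {v}" using that by auto
    then show ?thesis
      using card_arcs_from[of "parcs G" "\<lambda>e. fst e \<in> S \<and> snd e \<in> S" v]
      by (simp add: out_degree_def out_arcs_def conj_assoc)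
  qed
  then show ?thesis unfolding dissociation_set_def dissoc_def by auto
qed

lemma dissociation_number_ge:
  assumes "finite (pverts G)" "S \<subseteq> pverts G" "dissoc (parcs G) S"
  shows "card S \<le> dissociation_number G"
proof -
  have "finite {S. dissociation_set G S}"
    by (rule finite_subset[of _ "Pow (pverts G)"]) (use assms in \<open>auto simp: dissociation_set_def\<close>)
  then have "finite (card ` {S. dissociation_set G S})" by (rule finite_imageI)
  then show ?thesis
    unfolding dissociation_number_def
    by (rule Max_ge) (use assms in \<open>auto simp: dissociation_set_iff\<close>)
qed

lemma dissociation_number_attained:
  assumes "finite (pverts G)"
  obtains S where "S \<subseteq> pverts G" "dissoc (parcs G) S" "card S = dissociation_number G"
proof -
  have "finite {S. dissociation_set G S}"
    by (rule finite_subset[of _ "Pow (pverts G)"]) (use assms in \<open>auto simp: dissociation_set_def\<close>)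
  moreover have "dissociation_set G {}" by (simp add: dissociation_set_def)
  ultimately have "dissociation_number G \<in> card ` {S. dissociation_set G S}"
    unfolding dissociation_number_def by (intro Max_in) auto
  then show ?thesis using that by (auto simp: dissociation_set_iff)
qed

lemma A_alpha_mult_vec:
  assumes V: "pverts G = {0..<n}" and G: "graph_on (pverts G) (parcs G)" and i: "i < n"
  shows "vec_index (A_alpha \<alpha> G *\<^sub>v Matrix.vec n f) i = A_act \<alpha> (parcs G) f i"
proof -
  have sub: "parcs G `` {i} \<subseteq> {0..<n}" using graph_onD(3)[OF G] V by auto
  have "vec_index (A_alpha \<alpha> G *\<^sub>v Matrix.vec n f) i =
      (\<Sum>j = 0..<n. \<alpha> * (if i = j then real (card (parcs G `` {i})) else 0) * f j
        + (1 - \<alpha>) * (if (i, j) \<in> parcs G then f j else 0))"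
    using i by (auto simp: A_alpha_def degree_mat_def adjacency_mat_def V scalar_prod_def
        out_degree_with_proj algebra_simps intro!: sum.cong)
  also have "\<dots> = (\<Sum>j = 0..<n. if i = j then \<alpha> * real (card (parcs G `` {i})) * f j else 0)
      + (1 - \<alpha>) * (\<Sum>j = 0..<n. if (i, j) \<in> parcs G then f j else 0)"
    unfolding sum_distrib_left sum.distrib[symmetric] by (rule sum.cong) auto
  also have "(\<Sum>j = 0..<n. if (i, j) \<in> parcs G then f j else 0) = (\<Sum>j\<in>parcs G `` {i}. f j)"
    by (rule sum.mono_neutral_cong_right) (use sub in auto)
  also have "(\<Sum>j = 0..<n. if i = j then \<alpha> * real (card (parcs G `` {i})) * f j else 0)
      = \<alpha> * real (card (parcs G `` {i})) * f i"
    using i by simp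
  finally show ?thesis by (simp add: A_act_def)
qed

text \<open>The positive vector puts \<open>l\<close> into the spectrum. For any other eigenvalue,
  inserting an eigenvector into the Rayleigh bound shows that it is at most
  \<open>l\<close>.\<close>

lemma A_alpha_index_eq:
  assumes V: "pverts G = {0..<n}" and n: "1 \<le> n" and G: "graph_on (pverts G) (parcs G)"
    and p: "perron_pair \<alpha> {0..<n} (parcs G) l x"
  shows "A_alpha_index \<alpha> G = l"
proof -
  define A where "A = A_alpha \<alpha> G"
  have A: "A \<in> carrier_mat n n"
    by (auto simp: A_def A_alpha_def degree_mat_def adjacency_mat_def V)
  have mult: "vec_index (A *\<^sub>v Matrix.vec n f) i = A_act \<alpha> (parcs G) f i" if "i < n" for f i
    unfolding A_def by (rule A_alpha_mult_vec[OF V G that])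
  have "A *\<^sub>v Matrix.vec n x = l \<cdot>\<^sub>v Matrix.vec n x"
    using A mult perron_pair_act[OF p] by (intro eq_vecI) auto
  moreover have "Matrix.vec n x \<noteq> 0\<^sub>v n"
  proof
    assume "Matrix.vec n x = 0\<^sub>v n"
    then have "vec_index (Matrix.vec n x) 0 = vec_index (0\<^sub>v n) 0" by simp
    then show False using n perron_pair_pos[OF p, of 0] by simp
  qed
  ultimately have "eigenvector A (Matrix.vec n x) l"
    using A unfolding eigenvector_def by auto
  then have "l \<in> spectrum A" by (auto simp: spectrum_def eigenvalue_def)
  have "k \<le> l" if "k \<in> spectrum A" for k
  proof -
    obtain v where v: "v \<in> carrier_vec n" "v \<noteq> 0\<^sub>v n" "A *\<^sub>v v = k \<cdot>\<^sub>v v"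
      using \<open>k \<in> spectrum A\<close> A unfolding spectrum_def eigenvalue_def eigenvector_def by auto
    define f where "f = (\<lambda>i. vec_index v i)"
    have vf: "v = Matrix.vec n f" using v by (auto simp: f_def)
    have act: "A_act \<alpha> (parcs G) f i = k * f i" if "i < n" for i
      using mult[OF that, of f] v that unfolding vf[symmetric] by (auto simp: f_def)
    have "A_form \<alpha> (parcs G) f = k * (\<Sum>i\<in>{0..<n}. (f i)\<^sup>2)"
      unfolding A_form_eq[OF G] V sum_distrib_left
      by (rule sum.cong) (auto simp: act power2_eq_square)
    moreover have "A_form \<alpha> (parcs G) f \<le> l * (\<Sum>i\<in>{0..<n}. (f i)\<^sup>2)" by (rule perron_pair_form[OF p])
    moreover have "0 < (\<Sum>i\<in>{0..<n}. (f i)\<^sup>2)"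
    proof -
      obtain i where "i < n" "f i \<noteq> 0"
        using v(1,2) unfolding f_def by (metis carrier_vecD eq_vecI index_zero_vec)
      then show ?thesis by (intro sum_pos2[of _ i]) auto
    qed
    ultimately show ?thesis by simp
  qed
  then show ?thesis
    unfolding A_alpha_index_def A_def[symmetric]
    using \<open>l \<in> spectrum A\<close> card_finite_spectrum(1)[OF A] by (intro Max_eqI) auto
qed

section \<open>Directed cycles, trees, and minimisers over an enlarged class\<close>

lemma pcas_successively:
  "pcas u p v \<Longrightarrow> set p \<subseteq> E \<Longrightarrow> pawalk_verts u p = u # map snd p \<and>
    successively (\<lambda>u v. (u, v) \<in> E) (u # map snd p) \<and> last (u # map snd p) = v"
proof (induction p arbitrary: u)
  case (Cons e p)
  then show ?case by (cases e) auto
qed simp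

text \<open>The heads of the arcs of a directed cycle are distinct and end at its base point, which
  is adjacent to the first head. So they form a closed path in the sense of
  \<open>acyclic_graph\<close>.\<close>

lemma tree_graphI:
  assumes "connected_graph G" and acyc: "acyclic_graph (parcs G)"
  shows "tree_graph G"
  unfolding tree_graph_def
proof (intro conjI notI)
  assume "\<exists>p. pre_digraph.cycle (with_proj G) p \<and> 3 \<le> length p"
  then obtain u p where p: "pcas u p u" "set p \<subseteq> parcs G" "distinct (tl (pawalk_verts u p))" "3 \<le> length p"
    unfolding pre_digraph.cycle_def pre_digraph.awalk_def
    by (auto simp: cas_with_proj_eq awalk_verts_with_proj_eq)
  define q where "q = map snd p"
  have "q \<noteq> []" "3 \<le> length q" using p(4) by (auto simp: q_def)
  moreover have "distinct q" "successively (\<lambda>u v. (u, v) \<in> parcs G) (u # q)" "last (u # q) = u"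
    using pcas_successively[OF p(1,2)] p(3) by (auto simp: q_def)
  ultimately have "vpath (parcs G) q" "(last q, hd q) \<in> parcs G"
    by (auto simp: vpath_def successively_Cons)
  then show False using acyc \<open>3 \<le> length q\<close> unfolding acyclic_graph_def by blast
qed fact

text \<open>The inequality, in place of equality, keeps the class closed under deleting a cycle
  edge, which can raise the dissociation number.\<close>

definition large_dissociation :: "nat \<Rightarrow> nat \<Rightarrow> nat pair_pre_digraph set" where
  "large_dissociation n \<tau> =
     {G. graph_of_order n G \<and> connected_graph G \<and> \<tau> \<le> dissociation_number G}"

definition index_minimizer :: "real \<Rightarrow> nat \<Rightarrow> nat \<Rightarrow> nat pair_pre_digraph \<Rightarrow> bool" where
  "index_minimizer \<alpha> n \<tau> G \<longleftrightarrow> G \<in> large_dissociation n \<tau> \<and>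
     (\<forall>H\<in>large_dissociation n \<tau>. A_alpha_index \<alpha> G \<le> A_alpha_index \<alpha> H)"

lemma finite_large_dissociation: "finite (large_dissociation n \<tau>)"
proof (rule finite_subset)
  let ?V = "{0..<n}"
  show "large_dissociation n \<tau> \<subseteq> (\<lambda>E. \<lparr>pverts = ?V, parcs = E\<rparr>) ` Pow (?V \<times> ?V)"
  proof
    fix G assume "G \<in> large_dissociation n \<tau>"
    then have "graph_on (pverts G) (parcs G)" "pverts G = ?V"
      by (auto simp: large_dissociation_def graph_of_order_def pair_graph_iff)
    then have "G = \<lparr>pverts = ?V, parcs = parcs G\<rparr>" "parcs G \<subseteq> ?V \<times> ?V"
      using graph_onD(3)[of "pverts G" "parcs G"] by auto
    then show "G \<in> (\<lambda>E. \<lparr>pverts = ?V, parcs = E\<rparr>) ` Pow (?V \<times> ?V)" by blast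
  qed
qed simp

lemma large_dissociationD:
  assumes "G \<in> large_dissociation n \<tau>"
  shows "pverts G = {0..<n}" "graph_on {0..<n} (parcs G)" "connected_on {0..<n} (parcs G)" "1 \<le> n"
    "connected_graph G" "graph_of_order n G" "\<tau> \<le> dissociation_number G"
  using assms by (auto simp: large_dissociation_def graph_of_order_def connected_graph_iff)

text \<open>This passes from matrices to Perron pairs: a competitor is given by its edge relation
  and a witness \<open>S\<close> for its dissociation number.\<close>

lemma index_minimizer_le:
  assumes G: "index_minimizer \<alpha> n \<tau> G"
    and F: "graph_on {0..<n} F" "connected_on {0..<n} F"
    and S: "S \<subseteq> {0..<n}" "dissoc F S" "\<tau> \<le> card S"
    and p: "perron_pair \<alpha> {0..<n} (parcs G) l x" "perron_pair \<alpha> {0..<n} F m y"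
  shows "l \<le> m"
proof -
  define H where "H = \<lparr>pverts = {0..<n}, parcs = F\<rparr>"
  have G': "G \<in> large_dissociation n \<tau>" using G by (simp add: index_minimizer_def)
  note D = large_dissociationD[OF G']
  have "card S \<le> dissociation_number H"
    by (rule dissociation_number_ge) (use S in \<open>auto simp: H_def\<close>)
  then have "H \<in> large_dissociation n \<tau>"
    using F S(3) D(4)
    by (auto simp: large_dissociation_def graph_of_order_def pair_graph_iff connected_graph_iff H_def)
  then have "A_alpha_index \<alpha> G \<le> A_alpha_index \<alpha> H" using G by (simp add: index_minimizer_def)
  moreover have "A_alpha_index \<alpha> G = l" by (rule A_alpha_index_eq[OF D(1,4) _ p(1)]) (use D in simp)
  moreover have "A_alpha_index \<alpha> H = m"
    by (rule A_alpha_index_eq[of H n, OF _ D(4) _]) (use F p(2) in \<open>auto simp: H_def\<close>)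
  ultimately show ?thesis by simp
qed

lemma index_minimizer_acyclic:
  assumes G: "index_minimizer \<alpha> n \<tau> G" and \<alpha>: "0 \<le> \<alpha>" "\<alpha> < 1"
  shows "acyclic_graph (parcs G)"
proof (rule ccontr)
  assume cyc: "\<not> acyclic_graph (parcs G)"
  have G': "G \<in> large_dissociation n \<tau>" using G by (simp add: index_minimizer_def)
  note D = large_dissociationD[OF G']
  obtain F u v where F: "graph_on {0..<n} F" "connected_on {0..<n} F" "parcs G = F \<union> edge u v"
    and uv: "(u, v) \<notin> F" "u \<in> {0..<n}" "v \<in> {0..<n}" "u \<noteq> v"
    using cycle_edge_ex[OF D(2,3) cyc] by blast
  obtain l x where p: "perron_pair \<alpha> {0..<n} (parcs G) l x"
    using perron_pair_ex[OF D(2,3) _ \<alpha>] D(4) by auto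
  obtain m y where q: "perron_pair \<alpha> {0..<n} F m y"
    using perron_pair_ex[OF F(1,2) _ \<alpha>] D(4) by auto
  obtain S where S: "S \<subseteq> pverts G" "dissoc (parcs G) S" "card S = dissociation_number G"
    using dissociation_number_attained[of G] D(1) by auto
  have SV: "S \<subseteq> {0..<n}" "finite S" using S(1) D(1) finite_subset by auto
  have "dissoc F S" by (rule dissoc_subset[OF S(2) _ SV(2) subset_refl]) (use F(3) in auto)
  then have "l \<le> m" using index_minimizer_le[OF G F(1,2) SV(1) _ _ p q] S D(7) by simp
  moreover have "m < l" by (rule perron_edge_less[OF F(1) uv(2-4,1) \<alpha> p[unfolded F(3)] q])
  ultimately show False by simp
qed

lemma index_minimizer_dissociation_number:
  assumes G: "index_minimizer \<alpha> n \<tau> G" and \<alpha>: "0 \<le> \<alpha>" "\<alpha> < 1" and \<tau>: "2 * n \<le> 3 * \<tau>"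
  shows "dissociation_number G = \<tau>"
proof (rule ccontr)
  assume "dissociation_number G \<noteq> \<tau>"
  have G': "G \<in> large_dissociation n \<tau>" using G by (simp add: index_minimizer_def)
  note D = large_dissociationD[OF G']
  obtain S where S: "S \<subseteq> pverts G" "dissoc (parcs G) S" "card S = dissociation_number G"
    using dissociation_number_attained[of G] D(1) by auto
  have SV: "S \<subseteq> {0..<n}" "finite S" using S(1) D(1) finite_subset by auto
  have card_S: "\<tau> < card S" using S(3) D(7) \<open>dissociation_number G \<noteq> \<tau>\<close> by simp
  obtain l x where p: "perron_pair \<alpha> {0..<n} (parcs G) l x"
    using perron_pair_ex[OF D(2,3) _ \<alpha>] D(4) by auto
  show False
  proof (cases "\<exists>c. 3 \<le> card (parcs G `` {c})")
    case True
    then obtain F w b where F: "graph_on {0..<n} F" "connected_on {0..<n} F" "F \<subseteq> parcs G \<union> edge w b"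
      and less: "\<And>m y. perron_pair \<alpha> {0..<n} F m y \<Longrightarrow> m < l"
      using rotation_ex[OF D(2,3) index_minimizer_acyclic[OF G \<alpha>] _ \<alpha> p] by blast
    obtain m y where q: "perron_pair \<alpha> {0..<n} F m y"
      using perron_pair_ex[OF F(1,2) _ \<alpha>] D(4) by auto
    have "dissoc F (S - {b})" by (rule dissoc_add_edge[OF S(2) F(3) SV(2)])
    \<comment> \<open>The strict bound on \<open>card S\<close> pays for the removal of
      \<open>b\<close>.\<close>
    moreover have "\<tau> \<le> card (S - {b})" using card_S by (cases "b \<in> S") (auto simp: card_Diff_singleton_if)
    ultimately have "l \<le> m"
      using index_minimizer_le[OF G F(1,2) _ _ _ p q, of "S - {b}"] SV by auto
    then show False using less[OF q] by simp
  next
    case False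
    \<comment> \<open>The graph now has a Hamiltonian path, so
      \<open>3 * card S \<le> 2 * n + 2\<close>, whereas \<open>card S \<ge> \<tau> + 1\<close>
      gives \<open>3 * card S \<ge> 2 * n + 3\<close>.\<close>
    have "card (parcs G `` {c}) \<le> 2" for c
    proof (rule ccontr)
      assume "\<not> card (parcs G `` {c}) \<le> 2"
      then have "3 \<le> card (parcs G `` {c})" by simp
      then show False using False by blast
    qed
    then obtain h where h: "vpath (parcs G) h" "set h = {0..<n}"
      using hamiltonian_path_ex[OF D(2,3)] by blast
    then have "length h = n" by (metis card_atLeastLessThan diff_zero distinct_card vpath_def)
    then have "3 * card (S \<inter> set h) \<le> 2 * n + 2"
      using dissoc_path_bound[OF D(2) S(2) SV(2) h(1)] by simp
    moreover have "S \<inter> set h = S" using SV h by auto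
    ultimately show False using card_S \<tau> by simp
  qed
qed

theorem theorem1p4:
  fixes n \<tau> :: nat and \<alpha> :: real and G :: "nat pair_pre_digraph"
  assumes "1 \<le> n"
    and "0 \<le> \<alpha>" and "\<alpha> < 1"
    and "int \<tau> \<ge> \<lceil>2 / 3 * real n\<rceil>"
    and "G \<in> connected_graphs n \<tau>"
    and "\<forall>H \<in> connected_graphs n \<tau>. A_alpha_index \<alpha> G \<le> A_alpha_index \<alpha> H"
  shows "tree_graph G"
proof -
  have G: "G \<in> large_dissociation n \<tau>"
    using assms(5) by (simp add: connected_graphs_def large_dissociation_def)
  have "2 / 3 * real n \<le> real \<tau>" using assms(4) by (simp add: ceiling_le_iff)
  then have \<tau>: "2 * n \<le> 3 * \<tau>" by linarith
  \<comment> \<open>A minimiser of the enlarged class has dissociation number exactly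
    \<open>\<tau>\<close>, so the index of \<open>G\<close> is at most its index. Thus
    \<open>G\<close> minimises over the enlarged class as well, and acyclicity applies to
    it.\<close>
  obtain H where H: "index_minimizer \<alpha> n \<tau> H"
    using ex_is_arg_min_if_finite[OF finite_large_dissociation[of n \<tau>], of "A_alpha_index \<alpha>"] G
    unfolding is_arg_min_linorder index_minimizer_def by blast
  then have "H \<in> connected_graphs n \<tau>"
    using index_minimizer_dissociation_number[OF H assms(2,3) \<tau>]
    by (simp add: index_minimizer_def large_dissociation_def connected_graphs_def)
  then have "A_alpha_index \<alpha> G \<le> A_alpha_index \<alpha> H" using assms(6) by blast
  then have "index_minimizer \<alpha> n \<tau> G"
    using H G unfolding index_minimizer_def by (meson order_trans)
  then have "acyclic_graph (parcs G)" by (rule index_minimizer_acyclic[OF _ assms(2,3)])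
  then show ?thesis using large_dissociationD(5)[OF G] by (intro tree_graphI)
qed

end
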